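(* The holomorphic map $$f\colon\Delta^3\longrightarrow\Omega_{\mathrm{VI}},\qquad f(z_1,z_2,z_3)=(z_1,z_2,z_3,0,0,0),$$ is an isometric embedding, i.e. $g_{\Delta^3}=f^*g_{\Omega_{\mathrm{VI}}}$, and is totally geodesic. Consequently, $$\Pi=\operatorname{Im}(f)=\{(z_1,z_2,z_3,Z_1,Z_2,Z_3)\in\Omega_{\mathrm{VI}} : Z_1=Z_2=Z_3=0\}$$ is a totally geodesic polydisk of maximal rank in $\Omega_{\mathrm{VI}}$ (that is, of complex dimension equal to the rank of $\Omega_{\mathrm{VI}}$, which is $3$).
   Context: Let $\mathbb{O}_{\mathbb{C}}=\mathbb{O}\otimes_{\mathbb{R}}\mathbb{C}$ be the complexified octonions with standard Cayley basis $1,e_1,\dots,e_7$. Write $Z=z_0+\mathbf z=z_0+\sum_{j=1}^7z_je_j$ and $W=w_0+\mathbf w=w_0+\sum_{j=1}^7w_je_j$ with $z_j,w_j\in\mathbb{C}$. Put $\widetilde Z=z_0-\mathbf z$ (Cayley conjugation), $\overline Z=\overline{z_0}+\overline{\mathbf z}$ (complex conjugation), $\langle\mathbf z,\mathbf w\rangle=\sum_{j=1}^7z_jw_j$, $\langle Z,W\rangle=z_0w_0+\langle\mathbf z,\mathbf w\rangle$, and let the complex-bilinear octonionic product be $ZW=(z_0w_0-\langle\mathbf z,\mathbf w\rangle,\ z_0\mathbf w+w_0\mathbf z+\mathbf z\times\mathbf w)$, where $\mathbf z\times\mathbf w$ is the complex-bilinear extension of the Cayley cross product to $\mathbb{C}^7$.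 Let $\mathcal H=\{z=(z_1,z_2,z_3,Z_1,Z_2,Z_3) : z_j\in\mathbb{C},\ Z_j\in\mathbb{O}_{\mathbb{C}}\}\cong\mathbb{C}^{27}$, with complex conjugation $z\mapsto\bar z$ taken componentwise and Hermitian form $(x\mid y)=\sum_{j=1}^3z_j\overline{w_j}+\sum_{j=1}^3\langle Z_j,\overline{W_j}\rangle$ for $x=(z_j,Z_j)$, $y=(w_j,W_j)$. The Freudenthal adjoint is $$z^\sharp=\Bigl(z_2z_3-\tfrac12\langle Z_1,Z_1\rangle,\ z_3z_1-\tfrac12\langle Z_2,Z_2\rangle,\ z_1z_2-\tfrac12\langle Z_3,Z_3\rangle,\ Z_2Z_3-z_1\widetilde Z_1,\ Z_3Z_1-z_2\widetilde Z_2,\ Z_1Z_2-z_3\widetilde Z_3\Bigr).$$ The exceptional bounded symmetric domain of type VI, $\Omega_{\mathrm{VI}}\subset\mathcal H$ (complex dimension 27, rank 3), is the set of $z\in\mathcal H$ with $$1-(z\mid z)+(z^\sharp\mid z^\sharp)-\bigl|\tfrac13(z^\sharp\mid\bar z)\bigr|^2>0,\quad 3-2(z\mid z)+(z^\sharp\mid z^\sharp)>0,\quad 3-(z\mid z)>0.$$ Its generic norm is $N_{\Omega_{\mathrm{VI}}}(z,\bar w)=1-(z\mid w)+(z^\sharp\mid w^\sharp)-\frac19(z^\sharp\mid\bar z)(\bar w^\sharp\mid w)$ for $z,w\in\mathcal H$, and its hyperbolic metric $g_{\Omega_{\mathrm{VI}}}$ is the Kähler metric with Kähler form $-\frac i2\partial\bar\partial\log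 N_{\Omega_{\mathrm{VI}}}(z,\bar z)$. $\Delta^3=\{z\in\mathbb{C}^3 : |z_j|<1,\ j=1,2,3\}$ carries the Kähler metric $g_{\Delta^3}$ with Kähler form $-\frac i2\partial\bar\partial\log\prod_{j=1}^3(1-|z_j|^2)$. A totally geodesic polydisk in $\Omega_{\mathrm{VI}}$ is the image of a totally geodesic holomorphic isometric embedding of some $(\Delta^k,g_{\Delta^k})$ (same definition with $k$ factors). An isometric embedding is totally geodesic if its second fundamental form vanishes. *)

theory Defs
  imports "HOL-Analysis.Analysis" "HOL-Computational_Algebra.Polynomial"
begin

section \<open>Complexified octonions\<close>

text \<open>An element \<open>z\<^sub>0 + \<Sum>z\<^sub>j e\<^sub>j\<close> is the pair of its scalar part \<open>z\<^sub>0\<close> and its vector part.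
  The index type \<open>7\<close> is the ring of integers modulo 7, so that \<open>e\<^sub>7\<close> is the unit with index
  \<open>7 = 0\<close>.\<close>

type_synonym octc = "complex \<times> (complex ^ 7)"

definition bdot :: "complex ^ 'n \<Rightarrow> complex ^ 'n \<Rightarrow> complex"
  where "bdot z w = (\<Sum>j\<in>UNIV. z $ j * w $ j)"

text \<open>The Cayley table is \<open>e\<^sub>i e\<^bsub>i+1\<^esub> = e\<^bsub>i+3\<^esub>\<close> (indices modulo 7), together with the cyclic
  permutations of each triple \<open>(i, i+1, i+3)\<close>. The unit \<open>e\<^sub>k\<close> lies on the three triples with
  \<open>i = k - 3\<close>, \<open>i = k\<close> and \<open>i = k - 1\<close>, which contribute the three lines below.\<close>

definition cross7 :: "complex ^ 7 \<Rightarrow> complex ^ 7 \<Rightarrow> complex ^ 7"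
  where "cross7 z w = (\<chi> k.
      (z $ (k - 3) * w $ (k - 2) - z $ (k - 2) * w $ (k - 3))
    + (z $ (k + 1) * w $ (k + 3) - z $ (k + 3) * w $ (k + 1))
    + (z $ (k + 2) * w $ (k - 1) - z $ (k - 1) * w $ (k + 2)))"

definition oct_mult :: "octc \<Rightarrow> octc \<Rightarrow> octc"
  where "oct_mult Z W =
    (fst Z * fst W - bdot (snd Z) (snd W),
     fst Z *s snd W + fst W *s snd Z + cross7 (snd Z) (snd W))"

definition oct_scale :: "complex \<Rightarrow> octc \<Rightarrow> octc"
  where "oct_scale c Z = (c * fst Z, c *s snd Z)"

definition cayley_conj :: "octc \<Rightarrow> octc"
  where "cayley_conj Z = (fst Z, - snd Z)"

definition oct_cnj :: "octc \<Rightarrow> octc"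
  where "oct_cnj Z = (cnj (fst Z), (\<chi> j. cnj (snd Z $ j)))"

definition oct_dot :: "octc \<Rightarrow> octc \<Rightarrow> complex"
  where "oct_dot Z W = fst Z * fst W + bdot (snd Z) (snd W)"


section \<open>The space \<open>H\<close> of dimension 27\<close>

text \<open>The coordinate \<open>Inl j\<close> is the scalar \<open>z\<^sub>j\<close>; \<open>Inr (j, None)\<close> and \<open>Inr (j, Some k)\<close> are the
  scalar part and the \<open>k\<close>-th vector coordinate of the octonion \<open>Z\<^sub>j\<close>. The index type has
  3 + 3 * 8 = 27 elements, and \<open>j = 3\<close> in type \<open>3\<close> is represented as \<open>0\<close>.\<close>

type_synonym hspace = "complex ^ (3 + 3 \<times> 7 option)"

definition hscal :: "hspace \<Rightarrow> 3 \<Rightarrow> complex"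
  where "hscal z j = z $ Inl j"

definition hoct :: "hspace \<Rightarrow> 3 \<Rightarrow> octc"
  where "hoct z j = (z $ Inr (j, None), (\<chi> k. z $ Inr (j, Some k)))"

definition hvec :: "complex \<Rightarrow> complex \<Rightarrow> complex \<Rightarrow> octc \<Rightarrow> octc \<Rightarrow> octc \<Rightarrow> hspace"
  where "hvec z1 z2 z3 Z1 Z2 Z3 =
    (\<chi> i. case i of
        Inl j \<Rightarrow> (vector [z1, z2, z3] :: complex ^ 3) $ j
      | Inr (j, None) \<Rightarrow> fst ((vector [Z1, Z2, Z3] :: octc ^ 3) $ j)
      | Inr (j, Some k) \<Rightarrow> snd ((vector [Z1, Z2, Z3] :: octc ^ 3) $ j) $ k)"

definition hcnj :: "hspace \<Rightarrow> hspace"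
  where "hcnj z = (\<chi> i. cnj (z $ i))"

definition hform :: "hspace \<Rightarrow> hspace \<Rightarrow> complex"
  where "hform x y = (\<Sum>j\<in>UNIV. hscal x j * cnj (hscal y j))
                   + (\<Sum>j\<in>UNIV. oct_dot (hoct x j) (oct_cnj (hoct y j)))"

definition sharp :: "hspace \<Rightarrow> hspace"
  where "sharp z =
    (let z1 = hscal z 1; z2 = hscal z 2; z3 = hscal z 3;
         Z1 = hoct z 1; Z2 = hoct z 2; Z3 = hoct z 3
     in hvec
          (z2 * z3 - oct_dot Z1 Z1 / 2)
          (z3 * z1 - oct_dot Z2 Z2 / 2)
          (z1 * z2 - oct_dot Z3 Z3 / 2)
          (oct_mult Z2 Z3 - oct_scale z1 (cayley_conj Z1))
          (oct_mult Z3 Z1 - oct_scale z2 (cayley_conj Z2))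
          (oct_mult Z1 Z2 - oct_scale z3 (cayley_conj Z3)))"


section \<open>The exceptional domain of type VI\<close>

text \<open>\<open>hform x x\<close> is a real number for every \<open>x\<close>, so taking real parts loses nothing.\<close>

definition Omega_VI :: "hspace set"
  where "Omega_VI = {z.
      1 - Re (hform z z) + Re (hform (sharp z) (sharp z))
        - (cmod (hform (sharp z) (hcnj z) / 3))\<^sup>2 > 0
    \<and> 3 - 2 * Re (hform z z) + Re (hform (sharp z) (sharp z)) > 0
    \<and> 3 - Re (hform z z) > 0}"

text \<open>\<open>generic_norm_VI z w\<close> is \<open>N(z, w\<^sup>-)\<close>, holomorphic in \<open>z\<close> and antiholomorphic in \<open>w\<close>.\<close>

definition generic_norm_VI :: "hspace \<Rightarrow> hspace \<Rightarrow> complex"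
  where "generic_norm_VI z w =
    1 - hform z w + hform (sharp z) (sharp w)
      - 1 / 9 * hform (sharp z) (hcnj z) * hform (sharp (hcnj w)) w"

text \<open>The rank of a bounded symmetric domain (of its Hermitian positive Jordan triple system) is
  the degree of the generic minimal polynomial \<open>m(T,x,y) = T\<^sup>r N(x/T, y)\<close>, that is, the degree of
  the generic norm \<open>N\<close> as a polynomial in its first argument.\<close>

definition generic_norm_rank :: "(complex ^ 'n \<Rightarrow> complex ^ 'n \<Rightarrow> complex) \<Rightarrow> nat"
  where "generic_norm_rank N =
    (LEAST r. \<forall>z w. \<exists>q :: complex poly. degree q \<le> r \<and> (\<forall>t. poly q t = N (t *s z) w))"

definition rank_Omega_VI :: nat
  where "rank_Omega_VI = generic_norm_rank generic_norm_VI"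


section \<open>Kaehler metrics\<close>

abbreviation dderiv ::
    "('a::real_normed_vector \<Rightarrow> 'b::real_normed_vector) \<Rightarrow> 'a \<Rightarrow> 'a \<Rightarrow> 'b"
  where "dderiv f p v \<equiv> frechet_derivative f (at p) v"

definition wirtinger :: "'n::finite \<Rightarrow> (complex ^ 'n \<Rightarrow> complex) \<Rightarrow> complex ^ 'n \<Rightarrow> complex"
  where "wirtinger a f p = (dderiv f p (axis a 1) - \<i> * dderiv f p (axis a \<i>)) / 2"

definition wirtinger_bar :: "'n::finite \<Rightarrow> (complex ^ 'n \<Rightarrow> complex) \<Rightarrow> complex ^ 'n \<Rightarrow> complex"
  where "wirtinger_bar a f p = (dderiv f p (axis a 1) + \<i> * dderiv f p (axis a \<i>)) / 2"

text \<open>The two-form \<open>\<partial>\<partial>\<^sup>- f\<close> at \<open>p\<close>, evaluated on the tangent vectors \<open>u\<close>, \<open>v\<close>, with the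
  convention \<open>(\<alpha> \<and> \<beta>)(u, v) = \<alpha>(u) \<beta>(v) - \<alpha>(v) \<beta>(u)\<close>.\<close>

definition ddbar ::
    "(complex ^ 'n::finite \<Rightarrow> complex) \<Rightarrow> complex ^ 'n \<Rightarrow> complex ^ 'n \<Rightarrow> complex ^ 'n \<Rightarrow> complex"
  where "ddbar f p u v =
    (\<Sum>a\<in>UNIV. \<Sum>b\<in>UNIV. wirtinger a (wirtinger_bar b f) p
                              * (u $ a * cnj (v $ b) - v $ a * cnj (u $ b)))"

type_synonym 'n metric = "complex ^ 'n \<Rightarrow> complex ^ 'n \<Rightarrow> complex ^ 'n \<Rightarrow> real"

definition kaehler_form :: "(complex ^ 'n::finite \<Rightarrow> real) \<Rightarrow> 'n metric"
  where "kaehler_form N p u v =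
    Re (- (\<i> / 2) * ddbar (\<lambda>z. complex_of_real (ln (N z))) p u v)"

text \<open>The metric with Kaehler form \<open>\<omega>\<close> is \<open>g(u, v) = \<omega>(u, J v)\<close>.\<close>

definition kaehler_metric :: "(complex ^ 'n::finite \<Rightarrow> real) \<Rightarrow> 'n metric"
  where "kaehler_metric N p u v = kaehler_form N p u (\<i> *s v)"

definition g_Omega_VI :: "(3 + 3 \<times> 7 option) metric"
  where "g_Omega_VI = kaehler_metric (\<lambda>z. Re (generic_norm_VI z z))"

definition polydisk :: "(complex ^ 'k) set"
  where "polydisk = {z. \<forall>j. cmod (z $ j) < 1}"

definition g_polydisk :: "'k::finite metric"
  where "g_polydisk = kaehler_metric (\<lambda>z. \<Prod>j\<in>UNIV. 1 - (cmod (z $ j))\<^sup>2)"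


section \<open>Maps between open subsets of complex coordinate spaces\<close>

definition holomorphic_map ::
    "(complex ^ 'm) set \<Rightarrow> (complex ^ 'n) set \<Rightarrow> (complex ^ 'm \<Rightarrow> complex ^ 'n) \<Rightarrow> bool"
  where "holomorphic_map U V f \<longleftrightarrow>
    f ` U \<subseteq> V \<and>
    (\<forall>p\<in>U. f differentiable (at p) \<and> (\<forall>c v. dderiv f p (c *s v) = c *s dderiv f p v))"

definition isometric_embedding ::
    "(complex ^ 'm) set \<Rightarrow> 'm metric \<Rightarrow> (complex ^ 'n) set \<Rightarrow> 'n metric
      \<Rightarrow> (complex ^ 'm \<Rightarrow> complex ^ 'n) \<Rightarrow> bool"
  where "isometric_embedding U g V h f \<longleftrightarrow>
    f ` U \<subseteq> V \<and>
    (\<exists>f'. homeomorphism U (f ` U) f f') \<and>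
    (\<forall>p\<in>U. f differentiable (at p) \<and> inj (dderiv f p)) \<and>
    (\<forall>p\<in>U. \<forall>u v. g p u v = h (f p) (dderiv f p u) (dderiv f p v))"

text \<open>The Levi-Civita connection of \<open>g\<close>: \<open>christoffel g p u v\<close> is the covariant derivative at \<open>p\<close>
  of the constant vector field \<open>v\<close> in direction \<open>u\<close>. It is determined by the Koszul formula (the
  brackets of constant fields vanish); it exists uniquely where \<open>g p\<close> is nondegenerate.\<close>

definition christoffel ::
    "'n::finite metric \<Rightarrow> complex ^ 'n \<Rightarrow> complex ^ 'n \<Rightarrow> complex ^ 'n \<Rightarrow> complex ^ 'n"
  where "christoffel g p u v = (THE w. \<forall>x. g p w x =
    (dderiv (\<lambda>q. g q v x) p u + dderiv (\<lambda>q. g q u x) p v - dderiv (\<lambda>q. g q u v) p x) / 2)"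

text \<open>The covariant derivative, in direction \<open>u\<close>, of the image under \<open>df\<close> of the constant field
  \<open>v\<close>, as a vector field along \<open>f\<close>.\<close>

definition covariant_deriv_along ::
    "'n::finite metric \<Rightarrow> (complex ^ 'm \<Rightarrow> complex ^ 'n) \<Rightarrow> complex ^ 'm \<Rightarrow> complex ^ 'm
      \<Rightarrow> complex ^ 'm \<Rightarrow> complex ^ 'n"
  where "covariant_deriv_along h f p u v =
    dderiv (\<lambda>q. dderiv f q v) p u + christoffel h (f p) (dderiv f p u) (dderiv f p v)"

text \<open>The second fundamental form is the component of this vector normal to the image of \<open>df\<close>.\<close>

definition second_fundamental_form ::
    "'n::finite metric \<Rightarrow> (complex ^ 'm \<Rightarrow> complex ^ 'n) \<Rightarrow> complex ^ 'm \<Rightarrow> complex ^ 'm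
      \<Rightarrow> complex ^ 'm \<Rightarrow> complex ^ 'n"
  where "second_fundamental_form h f p u v =
    (THE n. (\<forall>t. h (f p) n (dderiv f p t) = 0) \<and>
            covariant_deriv_along h f p u v - n \<in> range (dderiv f p))"

definition totally_geodesic ::
    "(complex ^ 'm) set \<Rightarrow> 'n::finite metric \<Rightarrow> (complex ^ 'm \<Rightarrow> complex ^ 'n) \<Rightarrow> bool"
  where "totally_geodesic U h f \<longleftrightarrow> (\<forall>p\<in>U. \<forall>u v. second_fundamental_form h f p u v = 0)"

text \<open>The complex dimension of the polydisk is the cardinality of the index type \<open>'k\<close>.\<close>

definition totally_geodesic_polydisk ::
    "'k::finite itself \<Rightarrow> (complex ^ 'n) set \<Rightarrow> 'n::finite metric \<Rightarrow> (complex ^ 'n) set \<Rightarrow> bool"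
  where "totally_geodesic_polydisk T V h S \<longleftrightarrow>
    (\<exists>f :: complex ^ 'k \<Rightarrow> complex ^ 'n.
        holomorphic_map polydisk V f \<and>
        isometric_embedding polydisk g_polydisk V h f \<and>
        totally_geodesic polydisk h f \<and>
        S = f ` polydisk)"

definition f_VI :: "complex ^ 3 \<Rightarrow> hspace"
  where "f_VI z = hvec (z $ 1) (z $ 2) (z $ 3) 0 0 0"

end

theory Submission
  imports Defs
begin

text \<open>The generic norm of the exceptional domain, on the diagonal, is the signed sum of squares
  \<open>1 - \<Sum>|z\<^sub>i|\<^sup>2 + \<Sum>|(z\<^sup>\<sharp>)\<^sub>i|\<^sup>2 - |D z|\<^sup>2\<close>, where \<open>D\<close> is the cubic form; all terms are polynomials. On
  the polydisk the octonions vanish and this factors as \<open>\<Prod>(1 - |z\<^sub>j|\<^sup>2)\<close>. The embedding is complex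
  linear, so taking \<open>\<partial>\<partial>\<^sup>- log\<close> commutes with it, and the isometry follows (lemma \<open>pullback\<close>).

  The second fundamental form vanishes for reasons of symmetry. Changing the signs of two of the
  three octonions preserves the generic norm, hence the metric (lemma \<open>generic_norm_signs\<close>), and the
  common fixed points of these involutions form the subspace in which the octonions are zero. An
  isometry that fixes a point and two tangent vectors fixes the Christoffel vector they
  determine (lemma \<open>christoffel_fixed\<close>), so the covariant derivative of tangent fields is tangent.

  The argument needs the connection to exist, which means that the metric must be nondegenerate in
  all 27 complex directions along the polydisk. There it is computed explicitly (lemma
  \<open>metric_at_f_VI\<close>): it is the metric of the polydisk in the diagonal directions, and a positive
  multiple of the Euclidean one on each octonion. Only the values and first
  derivatives of the polynomials at the polydisk enter.

  The image is described by three inequalities. On the subspace they state that the elementary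
  symmetric functions of the numbers \<open>1 - |z\<^sub>j|\<^sup>2\<close> are positive, which forces each of the numbers to be
  positive. The rank is the degree of the norm along lines through the origin, which is read off at
  the unit element.\<close>

section \<open>Complex polynomial functions\<close>

text \<open>Polynomial functions are holomorphic, and their derivative in a fixed direction is polynomial
  again. This closure property supplies the repeated derivatives that the Levi form and the
  Christoffel symbols need.\<close>

inductive cpoly :: "(complex ^ 'n \<Rightarrow> complex) \<Rightarrow> bool" where
  cpoly_const: "cpoly (\<lambda>_. c)"
| cpoly_coord: "cpoly (\<lambda>z. z $ i)"
| cpoly_add: "cpoly f \<Longrightarrow> cpoly g \<Longrightarrow> cpoly (\<lambda>z. f z + g z)"
| cpoly_mult: "cpoly f \<Longrightarrow> cpoly g \<Longrightarrow> cpoly (\<lambda>z. f z * g z)"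

lemma cpoly_uminus: "cpoly f \<Longrightarrow> cpoly (\<lambda>z. - f z)"
  using cpoly_mult[OF cpoly_const[of "-1"]] by fastforce

lemma cpoly_diff: "cpoly f \<Longrightarrow> cpoly g \<Longrightarrow> cpoly (\<lambda>z. f z - g z)"
  using cpoly_add[OF _ cpoly_uminus] by fastforce

lemma cpoly_divide: "cpoly f \<Longrightarrow> cpoly (\<lambda>z. f z / c)"
  using cpoly_mult[OF _ cpoly_const[of "inverse c"]] by (simp add: divide_inverse)

lemma cpoly_sum: "(\<And>i. i \<in> I \<Longrightarrow> cpoly (f i)) \<Longrightarrow> cpoly (\<lambda>z. \<Sum>i\<in>I. f i z)"
  by (induction I rule: infinite_finite_induct) (auto intro: cpoly_const cpoly_add)

lemmas cpoly_intros = cpoly_const cpoly_coord cpoly_add cpoly_mult cpoly_uminus cpoly_diff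
  cpoly_divide cpoly_sum

lemma cpoly_derivative_exists:
  fixes f :: "complex ^ 'n::finite \<Rightarrow> complex"
  assumes "cpoly f"
  shows "\<exists>f'. (\<forall>p. (f has_derivative f' p) (at p)) \<and>
              (\<forall>p c v. f' p (c *s v) = c * f' p v) \<and> (\<forall>v. cpoly (\<lambda>p. f' p v))"
  using assms
proof induction
  case (cpoly_const c)
  show ?case by (rule exI[of _ "\<lambda>_ _. 0"]) (auto intro: cpoly.cpoly_const)
next
  case (cpoly_coord i)
  show ?case
    by (rule exI[of _ "\<lambda>_ v. v $ i"])
       (auto intro: cpoly.cpoly_const bounded_linear_imp_has_derivative bounded_linear_vec_nth)
next
  case (cpoly_add f g)
  then obtain f' g' where
    "\<forall>p. (f has_derivative f' p) (at p)" "\<forall>p c v. f' p (c *s v) = c * f' p v"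
    "\<forall>v. cpoly (\<lambda>p. f' p v)"
    "\<forall>p. (g has_derivative g' p) (at p)" "\<forall>p c v. g' p (c *s v) = c * g' p v"
    "\<forall>v. cpoly (\<lambda>p. g' p v)" by blast
  then show ?case
    by (intro exI[of _ "\<lambda>p v. f' p v + g' p v"])
       (auto intro: cpoly.cpoly_add has_derivative_add simp: algebra_simps)
next
  case (cpoly_mult f g)
  then obtain f' g' where
    "\<forall>p. (f has_derivative f' p) (at p)" "\<forall>p c v. f' p (c *s v) = c * f' p v"
    "\<forall>v. cpoly (\<lambda>p. f' p v)"
    "\<forall>p. (g has_derivative g' p) (at p)" "\<forall>p c v. g' p (c *s v) = c * g' p v"
    "\<forall>v. cpoly (\<lambda>p. g' p v)" by blast
  then show ?case using cpoly_mult.hyps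
    by (intro exI[of _ "\<lambda>p v. f p * g' p v + f' p v * g p"])
       (intro conjI allI cpoly.cpoly_add cpoly.cpoly_mult has_derivative_mult;
        simp add: algebra_simps)
qed

lemma cpoly_dderiv:
  fixes f :: "complex ^ 'n::finite \<Rightarrow> complex"
  assumes "cpoly f"
  shows cpoly_has_derivative: "(f has_derivative dderiv f p) (at p)"
    and cpoly_dderiv_scale: "dderiv f p (c *s v) = c * dderiv f p v"
    and cpoly_cpoly_dderiv: "cpoly (\<lambda>p. dderiv f p v)"
proof -
  obtain f' where f': "\<forall>p. (f has_derivative f' p) (at p)" 
    "\<forall>p c v. f' p (c *s v) = c * f' p v" "\<forall>v. cpoly (\<lambda>p. f' p v)"
    using cpoly_derivative_exists[OF assms] by blast
  have "dderiv f p = f' p" for p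
    using f'(1) by (metis frechet_derivative_at)
  then show "(f has_derivative dderiv f p) (at p)" "dderiv f p (c *s v) = c * dderiv f p v"
     "cpoly (\<lambda>p. dderiv f p v)" using f' by auto
qed

lemma scaleR_eq_cscale: "r *\<^sub>R (x :: complex ^ 'k) = complex_of_real r *s x"
  by (simp add: vec_eq_iff) (simp add: scaleR_conv_of_real)

lemma vec_eq_sum_axis: "(v :: complex ^ 'n::finite) = (\<Sum>a\<in>UNIV. v $ a *s axis a 1)"
  by (simp add: vec_eq_iff axis_def if_distrib cong: if_cong)

lemma cpoly_dderiv_add:
  fixes f :: "complex ^ 'n::finite \<Rightarrow> complex"
  assumes "cpoly f"
  shows "dderiv f p (u + v) = dderiv f p u + dderiv f p v"
  using has_derivative_linear[OF cpoly_has_derivative[OF assms]] by (rule linear_add)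

lemma cpoly_dderiv_expand:
  fixes f :: "complex ^ 'n::finite \<Rightarrow> complex"
  assumes "cpoly f"
  shows "dderiv f p v = (\<Sum>a\<in>UNIV. v $ a * dderiv f p (axis a 1))"
proof -
  have "linear (dderiv f p)"
    using cpoly_has_derivative[OF assms] has_derivative_linear by blast
  then have "dderiv f p (\<Sum>a\<in>UNIV. v $ a *s axis a 1) = (\<Sum>a\<in>UNIV. dderiv f p (v $ a *s axis a 1))"
    by (rule linear_sum)
  then show ?thesis using vec_eq_sum_axis[of v] cpoly_dderiv_scale[OF assms] by simp
qed

lemma cpoly_dderiv_axis_i:
  fixes f :: "complex ^ 'n::finite \<Rightarrow> complex"
  assumes "cpoly f"
  shows "dderiv f p (axis a \<i>) = \<i> * dderiv f p (axis a 1)"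
proof -
  have "axis a \<i> = \<i> *s (axis a 1 :: complex ^ 'n)" by (simp add: vec_eq_iff axis_def)
  then show ?thesis using cpoly_dderiv_scale[OF assms] by simp
qed

text \<open>A directional derivative is the linear coefficient of the expansion along the line through
  \<open>q\<close>; this reads off the derivatives of the adjoint and of the cubic form, which have degree
  2 and 3.\<close>

lemma cpoly_dderivI:
  fixes F :: "complex ^ 'n::finite \<Rightarrow> complex"
  assumes "cpoly F" and "\<And>t::complex. F (q + t *s w) = a + t * b + t\<^sup>2 * c + t ^ 3 * d"
  shows "dderiv F q w = b"
proof -
  have 1: "((\<lambda>t::real. q + t *\<^sub>R w) has_derivative (\<lambda>t. t *\<^sub>R w)) (at 0)"
    by (auto intro!: derivative_eq_intros)
  have "(F has_derivative dderiv F q) (at (q + 0 *\<^sub>R w))"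
    using cpoly_has_derivative[OF assms(1)] by simp
  from has_derivative_compose[OF 1 this]
  have "((\<lambda>t. F (q + t *\<^sub>R w)) has_derivative (\<lambda>t. dderiv F q (t *\<^sub>R w))) (at 0)" .
  moreover have "((\<lambda>t. F (q + t *\<^sub>R w)) has_derivative (\<lambda>t. of_real t * b)) (at 0)"
    unfolding scaleR_eq_cscale assms(2)
    by (auto intro!: derivative_eq_intros)
  ultimately have "(\<lambda>t::real. dderiv F q (t *\<^sub>R w)) = (\<lambda>t. of_real t * b)"
    by (rule has_derivative_unique)
  from fun_cong[OF this, of 1] show ?thesis by simp
qed

lemma dderiv_coord: "dderiv (\<lambda>z. z $ i) q w = (w $ i :: complex)"
  by (rule cpoly_dderivI[OF cpoly_coord, where a = "q $ i" and c = 0 and d = 0]) simp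

lemma cpoly_compose_linear:
  fixes A :: "complex ^ 'm::finite \<Rightarrow> complex ^ 'n::finite"
  assumes "cpoly f" and A: "Vector_Spaces.linear (*s) (*s) A"
  shows "cpoly (\<lambda>z. f (A z))"
  using assms(1)
proof induction
  case (cpoly_coord i)
  have "A z $ i = (\<Sum>j\<in>UNIV. matrix A $ i $ j * z $ j)" for z
    using arg_cong[OF matrix_works[OF A, of z], of "\<lambda>v. v $ i"]
    by (simp add: matrix_vector_mult_def)
  then show ?case by (simp add: cpoly_intros)
qed (auto intro: cpoly_intros)

lemma clinear_imp_linear:
  fixes A :: "complex ^ 'm::finite \<Rightarrow> complex ^ 'n::finite"
  assumes "Vector_Spaces.linear (*s) (*s) A"
  shows "linear A"
proof -
  interpret A: Vector_Spaces.linear "(*s)" "(*s)" A by fact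
  show ?thesis by (intro linearI) (auto simp: A.add A.scale scaleR_eq_cscale)
qed

section \<open>Kaehler metrics whose potential is a signed sum of squares\<close>

text \<open>A potential \<open>N = \<Sum>\<epsilon>\<^sub>k |F\<^sub>k|\<^sup>2\<close> with polynomial \<open>F\<^sub>k\<close> separates the holomorphic from the
  antiholomorphic variables: \<open>\<partial>\<close> falls on the factors \<open>F\<^sub>k\<close> and the conjugate operator on the
  factors \<open>cnj F\<^sub>k\<close>. So all derivatives of \<open>log N\<close> are explicit. The generic norm has this form on the
  diagonal, and the form is stable under composition with complex linear maps.\<close>

locale signed_squares =
  fixes N :: "complex ^ 'n::finite \<Rightarrow> real"
    and \<epsilon> :: "'k::finite \<Rightarrow> real" and F :: "'k \<Rightarrow> complex ^ 'n \<Rightarrow> complex"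
  assumes cpoly_F: "cpoly (F k)"
    and N_eq: "complex_of_real (N z) = (\<Sum>k\<in>UNIV. of_real (\<epsilon> k) * (F k z * cnj (F k z)))"
begin

text \<open>The form \<open>\<partial>N\<close>, the form \<open>\<partial>\<partial>\<^sup>-N\<close> as a sesquilinear form, and that of \<open>\<partial>\<partial>\<^sup>- log N\<close>.\<close>

definition del :: "complex ^ 'n \<Rightarrow> complex ^ 'n \<Rightarrow> complex"
  where "del p u = (\<Sum>k\<in>UNIV. of_real (\<epsilon> k) * (dderiv (F k) p u * cnj (F k p)))"

definition hess :: "complex ^ 'n \<Rightarrow> complex ^ 'n \<Rightarrow> complex ^ 'n \<Rightarrow> complex"
  where "hess p u v = (\<Sum>k\<in>UNIV. of_real (\<epsilon> k) * (dderiv (F k) p u * cnj (dderiv (F k) p v)))"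

definition levi :: "complex ^ 'n \<Rightarrow> complex ^ 'n \<Rightarrow> complex ^ 'n \<Rightarrow> complex"
  where "levi p u v = hess p u v / N p - del p u * cnj (del p v) / (N p)\<^sup>2"

lemma cnj_del: "cnj (del p u) = (\<Sum>k\<in>UNIV. of_real (\<epsilon> k) * (F k p * cnj (dderiv (F k) p u)))"
  unfolding del_def cnj_sum by (intro sum.cong) auto

lemma del_axis_i: "del p (axis a \<i>) = \<i> * del p (axis a 1)"
  unfolding del_def by (simp add: cpoly_dderiv_axis_i[OF cpoly_F] sum_distrib_left mult_ac)

lemma N_has_derivative:
  "((\<lambda>z. complex_of_real (N z)) has_derivative (\<lambda>v. del p v + cnj (del p v))) (at p)"
proof -
  have "((\<lambda>z. \<Sum>k\<in>UNIV. of_real (\<epsilon> k) * (F k z * cnj (F k z))) has_derivative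
     (\<lambda>v. \<Sum>k\<in>UNIV. of_real (\<epsilon> k) * (F k p * cnj (dderiv (F k) p v) + dderiv (F k) p v * cnj (F k p)))) (at p)"
    by (intro has_derivative_sum has_derivative_mult_right has_derivative_mult has_derivative_cnj
        cpoly_has_derivative cpoly_F)
  then show ?thesis 
    unfolding N_eq cnj_del unfolding del_def
    by (simp add: sum.distrib distrib_left add.commute)
qed

lemma N_real_derivative: "(N has_derivative (\<lambda>v. 2 * Re (del p v))) (at p)"
  using has_derivative_Re[OF N_has_derivative[of p]] by simp

lemma open_positive: "open {z. 0 < N z}"
proof -
  have "continuous_on UNIV N"
    using N_real_derivative has_derivative_continuous by (blast intro: continuous_at_imp_continuous_on)
  then show ?thesis by (intro open_Collect_less continuous_on_const)
qed

text \<open>In \<open>dN = \<partial>N + \<partial>\<^sup>-N\<close> the summand \<open>\<partial>N\<close> is complex linear, so its values in the directions \<open>1\<close>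
  and \<open>\<i>\<close> cancel in the conjugate Wirtinger operator; \<open>\<partial>\<^sup>-N\<close> is counted twice and halved.\<close>

lemma wirtinger_bar_log:
  assumes "0 < N p"
  shows "wirtinger_bar b (\<lambda>z. complex_of_real (ln (N z))) p = cnj (del p (axis b 1)) / N p"
proof -
  have "((\<lambda>z. complex_of_real (ln (N z))) has_derivative
      (\<lambda>v. complex_of_real (2 * Re (del p v) * inverse (N p)))) (at p)"
    by (rule has_derivative_of_real[OF has_derivative_ln[OF assms N_real_derivative]])
  then have D: "dderiv (\<lambda>z. complex_of_real (ln (N z))) p = 
      (\<lambda>v. complex_of_real (2 * Re (del p v) * inverse (N p)))"
    by (rule frechet_derivative_at[symmetric])
  show ?thesis using assms unfolding wirtinger_bar_def D del_axis_i
    by (simp add: complex_eq_iff field_simps)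
qed

lemma wirtinger_wirtinger_bar_log:
  assumes "0 < N p"
  shows "wirtinger a (wirtinger_bar b (\<lambda>z. complex_of_real (ln (N z)))) p
    = levi p (axis a 1) (axis b 1)"
proof -
  let ?e = "axis b 1 :: complex ^ 'n"
  define G where "G = (\<lambda>z. cnj (del z ?e))"
  define G' where "G' = (\<lambda>v. \<Sum>k\<in>UNIV. of_real (\<epsilon> k) *
     (F k p * cnj (dderiv (\<lambda>q. dderiv (F k) q ?e) p v) + dderiv (F k) p v * cnj (dderiv (F k) p ?e)))"
  have "(G has_derivative G') (at p)"
    unfolding G_def cnj_del G'_def
    by (intro has_derivative_sum has_derivative_mult_right has_derivative_mult has_derivative_cnj
        cpoly_has_derivative cpoly_F cpoly_cpoly_dderiv)
  then have "((\<lambda>z. G z / complex_of_real (N z)) has_derivative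
      (\<lambda>v. - G p * (inverse (complex_of_real (N p)) * (del p v + cnj (del p v)) *
         inverse (complex_of_real (N p))) + G' v / complex_of_real (N p))) (at p)"
    by (intro has_derivative_divide N_has_derivative) (use assms in auto)
  then have "(wirtinger_bar b (\<lambda>z. complex_of_real (ln (N z))) has_derivative
      (\<lambda>v. - G p * (inverse (complex_of_real (N p)) * (del p v + cnj (del p v)) *
         inverse (complex_of_real (N p))) + G' v / complex_of_real (N p))) (at p)"
    by (rule has_derivative_transform_within_open[OF _ open_positive])
       (use assms in \<open>auto simp: wirtinger_bar_log G_def\<close>)
  then have D: "dderiv (wirtinger_bar b (\<lambda>z. complex_of_real (ln (N z)))) p =
      (\<lambda>v. - G p * (inverse (complex_of_real (N p)) * (del p v + cnj (del p v)) *
         inverse (complex_of_real (N p))) + G' v / complex_of_real (N p))"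
    by (rule frechet_derivative_at[symmetric])
  have "G' (axis a 1) - \<i> * G' (axis a \<i>) = 2 * hess p (axis a 1) ?e"
    unfolding G'_def hess_def sum_distrib_left sum_subtractf[symmetric]
      cpoly_dderiv_axis_i[OF cpoly_F] cpoly_dderiv_axis_i[OF cpoly_cpoly_dderiv[OF cpoly_F]]
    by (intro sum.cong refl) (simp add: algebra_simps)
  then have G': "G' (axis a 1) = \<i> * G' (axis a \<i>) + 2 * hess p (axis a 1) ?e"
    by (simp add: algebra_simps)
  show ?thesis using assms unfolding wirtinger_def D G' del_axis_i levi_def G_def
    by (simp add: field_simps power2_eq_square)
qed

lemma del_expand: "del p u = (\<Sum>a\<in>UNIV. u $ a * del p (axis a 1))"
proof -
  have "del p u = (\<Sum>k\<in>UNIV. \<Sum>a\<in>UNIV. u $ a * (of_real (\<epsilon> k) * (dderiv (F k) p (axis a 1) * cnj (F k p))))"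
    unfolding del_def
    by (subst cpoly_dderiv_expand[OF cpoly_F, of _ p u]) (simp add: sum_distrib_left sum_distrib_right mult_ac)
  also have "\<dots> = (\<Sum>a\<in>UNIV. u $ a * del p (axis a 1))"
    unfolding del_def by (subst sum.swap) (simp add: sum_distrib_left)
  finally show ?thesis .
qed

lemma hess_expand:
  "hess p u v = (\<Sum>a\<in>UNIV. \<Sum>b\<in>UNIV. u $ a * cnj (v $ b) * hess p (axis a 1) (axis b 1))"
proof -
  have "hess p u v = (\<Sum>k\<in>UNIV. \<Sum>a\<in>UNIV. \<Sum>b\<in>UNIV. u $ a * cnj (v $ b) *
     (of_real (\<epsilon> k) * (dderiv (F k) p (axis a 1) * cnj (dderiv (F k) p (axis b 1)))))"
    unfolding hess_def
    by (subst cpoly_dderiv_expand[OF cpoly_F, of _ p u],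
        subst cpoly_dderiv_expand[OF cpoly_F, of _ p v])
       (simp only: cnj_sum sum_product, simp add: sum_distrib_left mult_ac)
  also have "\<dots> = (\<Sum>a\<in>UNIV. \<Sum>b\<in>UNIV. u $ a * cnj (v $ b) * hess p (axis a 1) (axis b 1))"
    unfolding hess_def 
    by (subst sum.swap, rule sum.cong[OF refl], subst sum.swap) (simp add: sum_distrib_left)
  finally show ?thesis .
qed

lemma levi_expand:
  "levi p u v = (\<Sum>a\<in>UNIV. \<Sum>b\<in>UNIV. levi p (axis a 1) (axis b 1) * (u $ a * cnj (v $ b)))"
  unfolding levi_def
  by (subst hess_expand[of p u v], subst del_expand[of p u], subst del_expand[of p v])
     (simp add: sum_product sum_divide_distrib algebra_simps flip: sum_subtractf)

lemma levi_hermitian: "cnj (levi p u v) = levi p v u"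
  unfolding levi_def hess_def by (simp add: mult_ac)

lemma levi_scale_left: "levi p (c *s u) v = c * levi p u v"
proof -
  have "del p (c *s u) = c * del p u" "hess p (c *s u) v = c * hess p u v"
    unfolding hess_def del_def
    by (simp_all add: cpoly_dderiv_scale[OF cpoly_F] sum_distrib_left mult_ac)
  then show ?thesis unfolding levi_def by (simp add: algebra_simps)
qed

lemma levi_scale_right: "levi p u (c *s v) = cnj c * levi p u v"
  using levi_scale_left[of p c v u] levi_hermitian by (metis complex_cnj_mult)

lemma levi_add_left: "levi p (u + u') v = levi p u v + levi p u' v"
  unfolding levi_def hess_def del_def
  by (simp add: cpoly_dderiv_add[OF cpoly_F] algebra_simps sum.distrib add_divide_distrib)

lemma levi_add_right: "levi p u (v + v') = levi p u v + levi p u v'"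
  using levi_add_left[of p v v' u] levi_hermitian by (metis complex_cnj_add)

text \<open>The two-form \<open>\<partial>\<partial>\<^sup>- log N\<close> antisymmetrises the Levi form. Inserting \<open>\<i> v\<close> turns this into a
  symmetrisation, and the Levi form is Hermitian.\<close>

lemma kaehler_metric_eq:
  assumes "0 < N p"
  shows "kaehler_metric N p u v = - Re (levi p u v)"
proof -
  have "ddbar (\<lambda>z. complex_of_real (ln (N z))) p u w = levi p u w - levi p w u" for w
    unfolding ddbar_def wirtinger_wirtinger_bar_log[OF assms]
    by (subst levi_expand[of p u w], subst levi_expand[of p w u])
       (simp add: algebra_simps flip: sum_subtractf)
  moreover have "Re (levi p v u) = Re (levi p u v)"
    using levi_hermitian[of p u v] by (metis cnj.sel(1))
  ultimately show ?thesis
    unfolding kaehler_metric_def kaehler_form_def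
    by (simp add: levi_scale_left levi_scale_right)
qed

text \<open>This makes the derivatives in the Koszul formula meaningful.\<close>

lemma differentiable_metric:
  assumes "0 < N p"
  shows "(\<lambda>q. kaehler_metric N q u v) differentiable (at p)"
proof -
  have F: "F k differentiable (at p)" "(\<lambda>q. dderiv (F k) q w) differentiable (at p)" for k w
    using cpoly_has_derivative cpoly_F cpoly_cpoly_dderiv differentiableI by metis+
  have C: "(\<lambda>q. cnj (f q)) differentiable (at p)" if "f differentiable (at p)"
    for f :: "complex ^ 'n \<Rightarrow> complex"
    using that has_derivative_cnj unfolding differentiable_def by blast
  have N: "(\<lambda>q. complex_of_real (N q)) differentiable (at p)"
    using N_has_derivative differentiableI by blast
  have "(\<lambda>q. levi q u v) differentiable (at p)"
    unfolding levi_def hess_def del_def of_real_power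
    by (intro differentiable_diff differentiable_divide differentiable_sum differentiable_mult
      differentiable_const F C N differentiable_power finite ballI) (use assms in auto)
  then have "(\<lambda>q. - Re (levi q u v)) differentiable (at p)"
    unfolding differentiable_def using has_derivative_Re has_derivative_minus by blast
  then obtain D where "((\<lambda>q. - Re (levi q u v)) has_derivative D) (at p)"
    unfolding differentiable_def by blast
  then have "((\<lambda>q. kaehler_metric N q u v) has_derivative D) (at p)"
    by (rule has_derivative_transform_within_open[OF _ open_positive])
       (use assms in \<open>auto simp: kaehler_metric_eq\<close>)
  then show ?thesis by (rule differentiableI)
qed

text \<open>A potential pulled back along a complex linear map defines the pulled back metric. With the
  inclusion of the polydisk this is the isometry, and with a linear symmetry of the potential it
  is the invariance of the metric.\<close>

lemma pullback:
  fixes A :: "complex ^ 'm::finite \<Rightarrow> complex ^ 'n"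
  assumes A: "Vector_Spaces.linear (*s) (*s) A" and "0 < N (A p)"
  shows "kaehler_metric (\<lambda>z. N (A z)) p u v = kaehler_metric N (A p) (A u) (A v)"
proof -
  interpret A: signed_squares "\<lambda>z. N (A z)" \<epsilon> "\<lambda>k z. F k (A z)"
    by unfold_locales (auto intro: cpoly_compose_linear[OF cpoly_F A] simp: N_eq)
  have "((\<lambda>z. F k (A z)) has_derivative (\<lambda>v. dderiv (F k) (A p) (A v))) (at p)" for k
    by (rule has_derivative_compose[of A A, OF linear_imp_has_derivative
          cpoly_has_derivative[OF cpoly_F]])
       (rule clinear_imp_linear[OF A])
  then have "dderiv (\<lambda>z. F k (A z)) p = (\<lambda>v. dderiv (F k) (A p) (A v))" for k
    by (rule frechet_derivative_at[symmetric])
  then have "A.levi p u v = levi (A p) (A u) (A v)"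
    unfolding levi_def A.levi_def hess_def A.hess_def del_def A.del_def by simp
  then show ?thesis using assms by (simp add: kaehler_metric_eq A.kaehler_metric_eq)
qed

end

section \<open>Fixed point sets of isometric involutions\<close>

text \<open>The definite descriptor for the Christoffel vector is meaningful by this form of the Riesz
  representation: \<open>w \<mapsto> g w\<close> is injective by positivity, hence onto for reasons of dimension.\<close>

lemma unique_representative:
  fixes g :: "'a::euclidean_space \<Rightarrow> 'a \<Rightarrow> real"
  assumes "bilinear g" and pos: "\<And>w. w \<noteq> 0 \<Longrightarrow> 0 < g w w" and "linear K"
  shows "\<exists>!w. \<forall>x. g w x = K x"
proof -
  have g1: "linear (\<lambda>w. g w x)" and g2: "linear (g w)" for w x
    using assms(1) by (auto simp: bilinear_def)
  define A where "A w = (\<Sum>b\<in>Basis. g w b *\<^sub>R b)" for w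
  have A: "A w \<bullet> x = g w x" for w x
  proof -
    have "g w x = g w (\<Sum>b\<in>Basis. (x \<bullet> b) *\<^sub>R b)" by (simp add: euclidean_representation)
    also have "\<dots> = (\<Sum>b\<in>Basis. (x \<bullet> b) * g w b)" by (simp add: linear_sum[OF g2] linear_scale[OF g2])
    finally show ?thesis
      unfolding A_def inner_sum_left by (auto intro!: sum.cong simp: inner_commute)
  qed
  have "linear A"
    unfolding A_def by (rule linearI)
      (simp_all add: linear_add[OF g1] linear_scale[OF g1] scaleR_left_distrib sum.distrib scaleR_sum_right)
  have inj: "inj A"
  proof (rule injI)
    fix w w' assume "A w = A w'"
    then have "A (w - w') = 0" by (simp add: linear_diff[OF \<open>linear A\<close>])
    then have "g (w - w') (w - w') = 0" by (metis A inner_zero_left)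
    then show "w = w'" using pos[of "w - w'"] by fastforce
  qed
  then have "surj A" using \<open>linear A\<close> linear_injective_imp_surjective by blast
  then obtain w where w: "A w = (\<Sum>b\<in>Basis. K b *\<^sub>R b)" by (metis surjD)
  have "g w x = K x" for x
  proof -
    have "K x = K (\<Sum>b\<in>Basis. (x \<bullet> b) *\<^sub>R b)" by (simp add: euclidean_representation)
    also have "\<dots> = (\<Sum>b\<in>Basis. (x \<bullet> b) * K b)"
      by (simp add: linear_sum[OF \<open>linear K\<close>] linear_scale[OF \<open>linear K\<close>])
    also have "\<dots> = A w \<bullet> x" unfolding w inner_sum_left
      by (auto intro!: sum.cong simp: inner_commute)
    finally show ?thesis using A by simp
  qed
  moreover have "w' = w" if "\<forall>x. g w' x = K x" for w'
    using calculation that inj A by (metis injD vector_eq_rdot)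
  ultimately show ?thesis by blast
qed

text \<open>An isometry preserves the Levi-Civita connection, since the Koszul formula involves only the
  metric. Here \<open>\<sigma>\<close> is linear and fixes \<open>p\<close>, \<open>u\<close>, \<open>v\<close>, so it must fix the covariant derivative. This
  is the reason why fixed point sets of isometries are totally geodesic. As \<open>\<sigma>\<close> is an involution,
  substituting \<open>\<sigma> x\<close> for \<open>x\<close> in the Koszul formula moves \<open>\<sigma>\<close> from one slot of the metric to the
  other.\<close>

lemma christoffel_fixed:
  fixes g :: "'n::finite metric" and \<sigma> :: "complex ^ 'n \<Rightarrow> complex ^ 'n"
  assumes lin: "linear \<sigma>" and invol: "\<And>x. \<sigma> (\<sigma> x) = x"
    and S: "open S" "p \<in> S"
    and bil: "\<And>q. q \<in> S \<Longrightarrow> bilinear (g q)"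
    and pos: "\<And>w. w \<noteq> 0 \<Longrightarrow> 0 < g p w w"
    and diff: "\<And>x y. (\<lambda>q. g q x y) differentiable (at p)"
    and inv: "\<And>q x y. q \<in> S \<Longrightarrow> g (\<sigma> q) (\<sigma> x) (\<sigma> y) = g q x y"
    and fix_points: "\<sigma> p = p" "\<sigma> u = u" "\<sigma> v = v"
  shows "\<sigma> (christoffel g p u v) = christoffel g p u v"
proof -
  define K where "K x = (dderiv (\<lambda>q. g q v x) p u + dderiv (\<lambda>q. g q u x) p v
      - dderiv (\<lambda>q. g q u v) p x) / 2" for x
  have g2: "linear (g q w)" if "q \<in> S" for q w using bil[OF that] by (auto simp: bilinear_def)
  have has_deriv: "((\<lambda>q. g q a x) has_derivative dderiv (\<lambda>q. g q a x) p) (at p)" for a x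
    using diff frechet_derivative_works by blast
  have d1: "dderiv (\<lambda>q. g q a (x + y)) p b = dderiv (\<lambda>q. g q a x) p b + dderiv (\<lambda>q. g q a y) p b"
    for a b x y
  proof -
    have "((\<lambda>q. g q a x + g q a y) has_derivative
        (\<lambda>b. dderiv (\<lambda>q. g q a x) p b + dderiv (\<lambda>q. g q a y) p b)) (at p)"
      by (intro has_derivative_add has_deriv)
    then have "((\<lambda>q. g q a (x + y)) has_derivative
        (\<lambda>b. dderiv (\<lambda>q. g q a x) p b + dderiv (\<lambda>q. g q a y) p b)) (at p)"
      by (rule has_derivative_transform_within_open[OF _ S]) (simp add: linear_add[OF g2])
    from fun_cong[OF frechet_derivative_at[OF this], of b] show ?thesis by simp
  qed
  have d2: "dderiv (\<lambda>q. g q a (r *\<^sub>R x)) p b = r * dderiv (\<lambda>q. g q a x) p b" for a b r x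
  proof -
    from has_derivative_mult_right[OF has_deriv, of r]
    have "((\<lambda>q. r * g q a x) has_derivative (\<lambda>b. r * dderiv (\<lambda>q. g q a x) p b)) (at p)" .
    then have "((\<lambda>q. g q a (r *\<^sub>R x)) has_derivative (\<lambda>b. r * dderiv (\<lambda>q. g q a x) p b)) (at p)"
      by (rule has_derivative_transform_within_open[OF _ S]) (auto simp: linear_scale[OF g2])
    from fun_cong[OF frechet_derivative_at[OF this], of b] show ?thesis by simp
  qed
  have L: "linear (dderiv (\<lambda>q. g q u v) p)" using linear_frechet_derivative[OF diff] .
  then have K: "linear K"
    unfolding K_def by (intro linearI) (simp_all add: d1 d2 linear_add[OF L] linear_scale[OF L]
        algebra_simps add_divide_distrib diff_divide_distrib)
  have ex1: "\<exists>!w. \<forall>x. g p w x = K x"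
    by (rule unique_representative[OF bil[OF S(2)] pos K])
  have chr: "christoffel g p u v = (THE w. \<forall>x. g p w x = K x)"
    unfolding christoffel_def K_def ..
  have w: "g p (christoffel g p u v) x = K x" for x
    using theI'[OF ex1] chr by simp
  have \<sigma>: "(\<sigma> has_derivative \<sigma>) (at q)" for q by (rule linear_imp_has_derivative[OF lin])
  \<comment> \<open>Chain rule for \<open>\<sigma>\<close> at its fixed point \<open>p\<close>.\<close>
  have inv_d: "dderiv (\<lambda>q. g q (\<sigma> a) (\<sigma> x)) p (\<sigma> b) = dderiv (\<lambda>q. g q a x) p b" for a x b
  proof -
    have "((\<lambda>q. g q (\<sigma> a) (\<sigma> x)) has_derivative dderiv (\<lambda>q. g q (\<sigma> a) (\<sigma> x)) p) (at (\<sigma> p))"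
      using has_deriv fix_points by simp
    from has_derivative_compose[OF \<sigma> this]
    have "((\<lambda>q. g (\<sigma> q) (\<sigma> a) (\<sigma> x)) has_derivative 
        (\<lambda>b. dderiv (\<lambda>q. g q (\<sigma> a) (\<sigma> x)) p (\<sigma> b))) (at p)" .
    then have "((\<lambda>q. g q a x) has_derivative 
        (\<lambda>b. dderiv (\<lambda>q. g q (\<sigma> a) (\<sigma> x)) p (\<sigma> b))) (at p)"
      by (rule has_derivative_transform_within_open[OF _ S]) (simp add: inv)
    from fun_cong[OF frechet_derivative_at[OF this], of b] show ?thesis by simp
  qed
  have K\<sigma>: "K (\<sigma> x) = K x" for x
    unfolding K_def using inv_d[of v x u] inv_d[of u x v] inv_d[of u v x] fix_points by simp
  have "g p (\<sigma> (christoffel g p u v)) x = K x" for x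
    using inv[OF S(2), of "christoffel g p u v" "\<sigma> x"] w[of "\<sigma> x"] K\<sigma>[of x] fix_points invol by simp
  with w ex1 show ?thesis by blast
qed

section \<open>The adjoint, the cubic form and the generic norm\<close>

lemma sum_hspace:
  "(\<Sum>i\<in>UNIV. h (i :: 3 + 3 \<times> 7 option)) =
     (\<Sum>j\<in>UNIV. h (Inl j)) + (\<Sum>j\<in>UNIV. h (Inr (j, None)) + (\<Sum>k\<in>UNIV. h (Inr (j, Some k))))"
proof -
  have "(\<Sum>i\<in>UNIV. h i) = (\<Sum>j\<in>UNIV. h (Inl j)) + (\<Sum>i\<in>UNIV. h (Inr i))"
    by (subst UNIV_Plus_UNIV[symmetric], subst sum.Plus) auto
  also have "(\<Sum>i\<in>UNIV. h (Inr i)) = (\<Sum>j\<in>UNIV. \<Sum>o'\<in>UNIV. h (Inr (j, o')))"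
    by (subst sum.cartesian_product) simp
  finally show ?thesis by (simp add: UNIV_option_conv sum.reindex)
qed

lemma hform_eq_sum: "hform x y = (\<Sum>i\<in>UNIV. x $ i * cnj (y $ i))"
  unfolding hform_def sum_hspace hscal_def hoct_def oct_dot_def oct_cnj_def bdot_def by simp

lemma hspace_eqI:
  assumes "\<And>j. hscal x j = hscal y j" "\<And>j. hoct x j = hoct y j"
  shows "x = y"
proof -
  have "x $ i = y $ i" for i
  proof (cases i)
    case (Inl j) then show ?thesis using assms(1)[of j] by (simp add: hscal_def)
  next
    case (Inr b)
    obtain j k where b: "b = (j, k)" by fastforce
    show ?thesis
      using assms(2)[of j] by (cases k) (simp_all add: Inr b hoct_def vec_eq_iff)
  qed
  then show ?thesis by (simp add: vec_eq_iff)
qed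

lemma hvec_simps [simp]:
  "hscal (hvec z1 z2 z3 Z1 Z2 Z3) 1 = z1" "hscal (hvec z1 z2 z3 Z1 Z2 Z3) 2 = z2"
  "hscal (hvec z1 z2 z3 Z1 Z2 Z3) 3 = z3" "hoct (hvec z1 z2 z3 Z1 Z2 Z3) 1 = Z1"
  "hoct (hvec z1 z2 z3 Z1 Z2 Z3) 2 = Z2" "hoct (hvec z1 z2 z3 Z1 Z2 Z3) 3 = Z3"
  by (simp_all add: hvec_def hscal_def hoct_def prod_eq_iff vec_eq_iff)

lemma hlin_simps [simp]:
  "hscal (x + y) j = hscal x j + hscal y j" "hscal (c *s x) j = c * hscal x j"
  "hoct (x + y) j = hoct x j + hoct y j" "hoct (c *s x) j = oct_scale c (hoct x j)"
  by (simp_all add: hscal_def hoct_def oct_scale_def prod_eq_iff vec_eq_iff)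

lemma sharp_simps:
  "hscal (sharp z) 1 = hscal z 2 * hscal z 3 - oct_dot (hoct z 1) (hoct z 1) / 2"
  "hscal (sharp z) 2 = hscal z 3 * hscal z 1 - oct_dot (hoct z 2) (hoct z 2) / 2"
  "hscal (sharp z) 3 = hscal z 1 * hscal z 2 - oct_dot (hoct z 3) (hoct z 3) / 2"
  "hoct (sharp z) 1 = oct_mult (hoct z 2) (hoct z 3) - oct_scale (hscal z 1) (cayley_conj (hoct z 1))"
  "hoct (sharp z) 2 = oct_mult (hoct z 3) (hoct z 1) - oct_scale (hscal z 2) (cayley_conj (hoct z 2))"
  "hoct (sharp z) 3 = oct_mult (hoct z 1) (hoct z 2) - oct_scale (hscal z 3) (cayley_conj (hoct z 3))"
  by (simp_all add: sharp_def Let_def)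

lemma hspace_eqI3:
  assumes "hscal x 1 = hscal y 1" "hscal x 2 = hscal y 2" "hscal x 3 = hscal y 3"
    "hoct x 1 = hoct y 1" "hoct x 2 = hoct y 2" "hoct x 3 = hoct y 3"
  shows "x = y"
  using assms by (intro hspace_eqI) (metis exhaust_3)+

lemma oct_scale_simps:
  "oct_dot (oct_scale a Z) (oct_scale b W) = a * b * oct_dot Z W"
  "oct_mult (oct_scale a Z) (oct_scale b W) = oct_scale (a * b) (oct_mult Z W)"
  "cayley_conj (oct_scale a Z) = oct_scale a (cayley_conj Z)"
  "oct_scale a (oct_scale b Z) = oct_scale (a * b) Z"
  "oct_scale a (Z + W) = oct_scale a Z + oct_scale a W"
  "oct_scale a (Z - W) = oct_scale a Z - oct_scale a W"
  "oct_scale (a + b) Z = oct_scale a Z + oct_scale b Z"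
  "oct_scale 1 Z = Z" "oct_scale 0 Z = 0"
  by (simp_all add: oct_dot_def oct_mult_def oct_scale_def cayley_conj_def bdot_def cross7_def
      prod_eq_iff vec_eq_iff sum_distrib_left algebra_simps)

lemma oct_zero_simps [simp]:
  "oct_dot 0 Z = 0" "oct_dot Z 0 = 0" "oct_mult 0 Z = 0" "oct_mult Z 0 = 0" "cayley_conj 0 = 0"
  "oct_cnj 0 = 0" "oct_scale c 0 = 0"
  by (simp_all add: oct_dot_def oct_mult_def cayley_conj_def bdot_def cross7_def oct_cnj_def
      oct_scale_def prod_eq_iff vec_eq_iff)

lemma oct_cnj_simps:
  "oct_dot (oct_cnj Z) (oct_cnj W) = cnj (oct_dot Z W)"
  "oct_mult (oct_cnj Z) (oct_cnj W) = oct_cnj (oct_mult Z W)"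
  "oct_scale (cnj a) (oct_cnj W) = oct_cnj (oct_scale a W)"
  "cayley_conj (oct_cnj W) = oct_cnj (cayley_conj W)"
  "oct_cnj Z - oct_cnj W = oct_cnj (Z - W)"
  by (simp_all add: oct_dot_def oct_mult_def oct_scale_def cayley_conj_def oct_cnj_def bdot_def cross7_def
      prod_eq_iff vec_eq_iff)

lemma hcnj_simps: "hscal (hcnj z) j = cnj (hscal z j)" "hoct (hcnj z) j = oct_cnj (hoct z j)"
  by (simp_all add: hscal_def hoct_def hcnj_def oct_cnj_def prod_eq_iff vec_eq_iff)

lemma sharp_hcnj: "sharp (hcnj z) = hcnj (sharp z)"
  by (rule hspace_eqI3) (simp_all add: sharp_simps hcnj_simps oct_cnj_simps)

lemma sharp_scale: "sharp (t *s z) = t\<^sup>2 *s sharp z"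
  by (rule hspace_eqI3)
     (simp_all add: sharp_simps oct_scale_simps power2_eq_square algebra_simps)

text \<open>The cubic norm of the Jordan algebra. The two conjugations, in \<open>hform\<close> and in \<open>hcnj\<close>, cancel,
  so it is a polynomial in the coordinates.\<close>

definition cubic_form :: "hspace \<Rightarrow> complex"
  where "cubic_form z = hform (sharp z) (hcnj z) / 3"

lemma cubic_form_eq_sum: "cubic_form z = (\<Sum>i\<in>UNIV. sharp z $ i * z $ i) / 3"
  by (simp add: cubic_form_def hform_eq_sum hcnj_def)

text \<open>The octonionic structure constants are real, so the adjoint commutes with conjugation and the
  last term of the generic norm is a product of a value of the cubic form and a conjugate value.
  On the diagonal it is therefore the square of an absolute value.\<close>

lemma generic_norm_eq:
  "generic_norm_VI z w = 1 - hform z w + hform (sharp z) (sharp w) - cubic_form z * cnj (cubic_form w)"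
proof -
  have "hform (sharp (hcnj w)) w = 3 * cnj (cubic_form w)"
    unfolding sharp_hcnj by (simp add: cubic_form_def hform_eq_sum hcnj_def)
  then show ?thesis by (simp add: generic_norm_VI_def cubic_form_def)
qed

lemma cpoly_components:
  "cpoly (\<lambda>z. hscal z j)" "cpoly (\<lambda>z. fst (hoct z j))" "cpoly (\<lambda>z. snd (hoct z j) $ k)"
  by (simp_all add: hscal_def hoct_def cpoly_coord)

lemma cpoly_sharp: "cpoly (\<lambda>z. sharp z $ i)"
proof -
  note defs = sharp_simps oct_dot_def oct_mult_def oct_scale_def cayley_conj_def bdot_def cross7_def
  consider j where "i = Inl j" | j where "i = Inr (j, None)" | j k where "i = Inr (j, Some k)"
    by (metis obj_sumE surj_pair option.exhaust)
  then show ?thesis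
  proof cases
    case 1
    have "cpoly (\<lambda>z. hscal (sharp z) j)"
      using exhaust_3[of j] by (auto simp: defs intro!: cpoly_intros cpoly_components)
    then show ?thesis by (simp add: 1 hscal_def)
  next
    case 2
    have "cpoly (\<lambda>z. fst (hoct (sharp z) j))"
      using exhaust_3[of j] by (auto simp: defs intro!: cpoly_intros cpoly_components)
    then show ?thesis by (simp add: 2 hoct_def)
  next
    case 3
    have "cpoly (\<lambda>z. snd (hoct (sharp z) j) $ k)"
      using exhaust_3[of j] by (auto simp: defs intro!: cpoly_intros cpoly_components)
    then show ?thesis by (simp add: 3 hoct_def)
  qed
qed

lemma cpoly_cubic_form: "cpoly cubic_form"
  unfolding cubic_form_eq_sum[abs_def] by (intro cpoly_intros cpoly_sharp)

type_synonym hidx = "3 + 3 \<times> 7 option"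

text \<open>The 56 polynomials whose absolute squares make up the generic norm on the diagonal: 27
  coordinates, 27 coordinates of the adjoint, the cubic form and the constant 1.\<close>

fun norm_term :: "(hidx + hidx) + bool \<Rightarrow> hspace \<Rightarrow> complex" where
  "norm_term (Inl (Inl i)) = (\<lambda>z. z $ i)"
| "norm_term (Inl (Inr i)) = (\<lambda>z. sharp z $ i)"
| "norm_term (Inr True) = cubic_form"
| "norm_term (Inr False) = (\<lambda>z. 1)"

fun norm_sign :: "(hidx + hidx) + bool \<Rightarrow> real" where
  "norm_sign (Inl (Inl i)) = -1"
| "norm_sign (Inl (Inr i)) = 1"
| "norm_sign (Inr True) = -1"
| "norm_sign (Inr False) = 1"

lemma sum_norm_term_index:
  fixes h :: "(hidx + hidx) + bool \<Rightarrow> complex"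
  shows "(\<Sum>k\<in>UNIV. h k) = (\<Sum>i\<in>UNIV. h (Inl (Inl i))) + (\<Sum>i\<in>UNIV. h (Inl (Inr i)))
    + h (Inr True) + h (Inr False)"
proof -
  have *: "(\<Sum>k\<in>UNIV. f k) = (\<Sum>i\<in>UNIV. f (Inl i)) + (\<Sum>i\<in>UNIV. f (Inr i))"
    for f :: "('a::finite + 'b::finite) \<Rightarrow> complex"
    by (subst UNIV_Plus_UNIV[symmetric], subst sum.Plus) auto
  show ?thesis by (simp add: * UNIV_bool)
qed

interpretation VI: signed_squares "\<lambda>z. Re (generic_norm_VI z z)" norm_sign norm_term
proof
  fix k
  show "cpoly (norm_term k)"
  proof (cases k)
    case (Inl i)
    then show ?thesis by (cases i) (auto intro: cpoly_intros cpoly_sharp)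
  next
    case (Inr b)
    then show ?thesis by (cases b) (auto intro: cpoly_intros cpoly_cubic_form)
  qed
next
  fix z
  have *: "hform x x = of_real (\<Sum>i\<in>UNIV. (cmod (x $ i))\<^sup>2)" for x
    unfolding hform_eq_sum complex_norm_square of_real_sum ..
  show "complex_of_real (Re (generic_norm_VI z z)) = (\<Sum>k\<in>UNIV. complex_of_real (norm_sign k) * (norm_term k z * cnj (norm_term k z)))"
    unfolding sum_norm_term_index generic_norm_eq
    using complex_norm_square[of "cubic_form z"]
    by (simp add: sum_negf * complex_eq_iff flip: hform_eq_sum)
qed

section \<open>The polydisk inside the domain\<close>

lemma f_VI_components [simp]: "hscal (f_VI p) j = p $ j" "hoct (f_VI p) j = 0"
  using exhaust_3[of j] by (auto simp: f_VI_def)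

lemma f_VI_clinear: "Vector_Spaces.linear (*s) (*s) f_VI"
  by unfold_locales
     (auto intro!: hspace_eqI simp: oct_scale_simps algebra_simps)

lemma linear_f_VI: "linear f_VI"
  by (rule clinear_imp_linear[OF f_VI_clinear])

lemma f_VI_has_derivative: "(f_VI has_derivative f_VI) (at p)"
  by (rule linear_imp_has_derivative[OF linear_f_VI])

lemma dderiv_f_VI: "dderiv f_VI p = f_VI"
  by (rule frechet_derivative_at[OF f_VI_has_derivative, symmetric])

lemma sharp_f_VI: "sharp (f_VI p) = f_VI (vector [p $ 2 * p $ 3, p $ 3 * p $ 1, p $ 1 * p $ 2])"
  by (rule hspace_eqI3) (simp_all add: sharp_simps)

lemma cubic_form_f_VI: "cubic_form (f_VI p) = p $ 1 * p $ 2 * p $ 3"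
  by (simp add: cubic_form_def hform_def sum_3 sharp_f_VI hcnj_simps oct_cnj_simps)

abbreviation defect :: "complex ^ 3 \<Rightarrow> 3 \<Rightarrow> real"
  where "defect p j \<equiv> 1 - (cmod (p $ j))\<^sup>2"

lemma hform_self_f_VI: "Re (hform (f_VI p) (f_VI p)) = (\<Sum>j\<in>UNIV. (cmod (p $ j))\<^sup>2)"
  by (simp add: hform_def flip: complex_norm_square)

lemma polydisk_defect: "p \<in> polydisk \<longleftrightarrow> (\<forall>j. 0 < defect p j)"
  by (simp add: polydisk_def power_less_one_iff abs_square_less_1)

text \<open>The domain conditions on the polydisk say that the elementary symmetric functions of
  \<open>1 - |p\<^sub>j|\<^sup>2\<close> are positive. The monic cubic with these three roots then has coefficients of
  alternating sign, so it is negative on the nonpositive axis and its roots are positive.\<close>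

lemma positive_of_elementary_symmetric:
  fixes a b c :: real
  assumes "0 < a * b * c" "0 < a * b + b * c + c * a" "0 < a + b + c"
  shows "0 < a" "0 < b" "0 < c"
proof -
  have *: "0 < a" if "0 < a * b * c" "0 < a * b + b * c + c * a" "0 < a + b + c" for a b c :: real
  proof (rule ccontr)
    assume "\<not> 0 < a"
    then have "a \<le> 0" by simp
    with that(1) have "a < 0" "b * c < 0"
      by (auto simp: mult.assoc zero_less_mult_iff)
    moreover have "a * (b + c) \<le> a * (- a)"
      using that(3) \<open>a < 0\<close> by (intro mult_left_mono_neg) auto
    moreover have "a * (- a) \<le> 0" by simp
    ultimately have "a * (b + c) + b * c < 0" by linarith
    then show False using that(2) by (simp add: algebra_simps)
  qed
  show "0 < a" "0 < b" "0 < c"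
    using *[of a b c] *[of b c a] *[of c a b] assms by (simp_all add: mult_ac add_ac)
qed

lemma f_VI_mem_Omega: "f_VI p \<in> Omega_VI \<longleftrightarrow> p \<in> polydisk"
proof -
  define a b c where "a = defect p 1" and "b = defect p 2" and "c = defect p 3"
  have 1: "1 - Re (hform (f_VI p) (f_VI p)) + Re (hform (sharp (f_VI p)) (sharp (f_VI p)))
      - (cmod (cubic_form (f_VI p)))\<^sup>2 = a * b * c"
    unfolding sharp_f_VI hform_self_f_VI cubic_form_f_VI a_def b_def c_def
    by (simp add: sum_3 norm_mult power_mult_distrib algebra_simps)
  have 2: "3 - 2 * Re (hform (f_VI p) (f_VI p)) + Re (hform (sharp (f_VI p)) (sharp (f_VI p)))
      = a * b + b * c + c * a"
    unfolding sharp_f_VI hform_self_f_VI a_def b_def c_def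
    by (simp add: sum_3 norm_mult power_mult_distrib algebra_simps)
  have 3: "3 - Re (hform (f_VI p) (f_VI p)) = a + b + c"
    unfolding hform_self_f_VI a_def b_def c_def by (simp add: sum_3)
  have "f_VI p \<in> Omega_VI \<longleftrightarrow> 0 < a * b * c \<and> 0 < a * b + b * c + c * a \<and> 0 < a + b + c"
    unfolding Omega_VI_def cubic_form_def[symmetric] mem_Collect_eq 1 2 3 ..
  also have "\<dots> \<longleftrightarrow> 0 < a \<and> 0 < b \<and> 0 < c"
    using positive_of_elementary_symmetric[of a b c]
    by (auto intro!: add_pos_pos mult_pos_pos)
  also have "\<dots> \<longleftrightarrow> p \<in> polydisk"
    unfolding polydisk_defect a_def b_def c_def by (metis exhaust_3)
  finally show ?thesis .
qed

lemma range_f_VI: "w \<in> range f_VI \<longleftrightarrow> (\<forall>j. hoct w j = 0)"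
proof
  assume "\<forall>j. hoct w j = 0"
  then have "w = f_VI (\<chi> j. hscal w j)" by (intro hspace_eqI) auto
  then show "w \<in> range f_VI" by blast
qed auto

lemma image_f_VI: "f_VI ` polydisk = {z \<in> Omega_VI. hoct z 1 = 0 \<and> hoct z 2 = 0 \<and> hoct z 3 = 0}"
proof -
  have "(hoct z 1 = 0 \<and> hoct z 2 = 0 \<and> hoct z 3 = 0) \<longleftrightarrow> z \<in> range f_VI" for z
    unfolding range_f_VI by (metis exhaust_3)
  then show ?thesis using f_VI_mem_Omega by auto
qed

section \<open>The metric along the polydisk\<close>

lemma generic_norm_f_VI:
  "Re (generic_norm_VI (f_VI p) (f_VI p)) = defect p 1 * defect p 2 * defect p 3"
proof -
  have "generic_norm_VI (f_VI p) (f_VI p) =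
     (1 - p $ 1 * cnj (p $ 1)) * (1 - p $ 2 * cnj (p $ 2)) * (1 - p $ 3 * cnj (p $ 3))"
    unfolding generic_norm_eq
    by (simp add: hform_def sum_3 sharp_f_VI cubic_form_f_VI algebra_simps)
  also have "\<dots> = complex_of_real (defect p 1 * defect p 2 * defect p 3)"
    by (simp flip: complex_norm_square)
  finally show ?thesis by simp
qed

lemma prod_3: "prod f (UNIV :: 3 set) = f 1 * f 2 * f 3"
  unfolding UNIV_3 by (simp add: mult.assoc)

lemma generic_norm_pos: "p \<in> polydisk \<Longrightarrow> 0 < Re (generic_norm_VI (f_VI p) (f_VI p))"
  by (simp add: generic_norm_f_VI polydisk_defect)

text \<open>The linear term of the adjoint at the point \<open>f_VI p\<close>. It maps octonionic directions to
  octonionic directions, scaled by \<open>- p\<^sub>j\<close>; this makes the metric block diagonal.\<close>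

definition sharp_deriv :: "complex ^ 3 \<Rightarrow> hspace \<Rightarrow> hspace"
  where "sharp_deriv p w = hvec
      (p $ 2 * hscal w 3 + p $ 3 * hscal w 2)
      (p $ 3 * hscal w 1 + p $ 1 * hscal w 3)
      (p $ 1 * hscal w 2 + p $ 2 * hscal w 1)
      (oct_scale (- p $ 1) (cayley_conj (hoct w 1)))
      (oct_scale (- p $ 2) (cayley_conj (hoct w 2)))
      (oct_scale (- p $ 3) (cayley_conj (hoct w 3)))"

lemma sharp_taylor:
  "sharp (f_VI p + t *s w) = sharp (f_VI p) + t *s sharp_deriv p w + t\<^sup>2 *s sharp w"
  by (rule hspace_eqI3)
     (simp_all add: sharp_simps sharp_deriv_def oct_scale_simps algebra_simps power2_eq_square,
      simp_all add: oct_scale_def cayley_conj_def prod_eq_iff vec_eq_iff algebra_simps)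

lemma dderiv_sharp: "dderiv (\<lambda>z. sharp z $ i) (f_VI p) w = sharp_deriv p w $ i"
  by (rule cpoly_dderivI[OF cpoly_sharp, where a = "sharp (f_VI p) $ i" and c = "sharp w $ i" and d = 0])
     (simp add: sharp_taylor)

lemma dderiv_cubic_form:
  "dderiv cubic_form (f_VI p) w =
     p $ 2 * p $ 3 * hscal w 1 + p $ 3 * p $ 1 * hscal w 2 + p $ 1 * p $ 2 * hscal w 3"
proof -
  define b where "b x y = (\<Sum>i\<in>UNIV. x $ i * y $ i)" for x y :: hspace
  have b: "b (x + y) z = b x z + b y z" "b z (x + y) = b z x + b z y"
      "b (t *s x) y = t * b x y" "b x (t *s y) = t * b x y" for x y z t
    by (simp_all add: b_def sum.distrib distrib_left distrib_right sum_distrib_left mult_ac)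
  have bf: "b x (f_VI p) = p $ 1 * hscal x 1 + p $ 2 * hscal x 2 + p $ 3 * hscal x 3"
      "b (f_VI p) x = p $ 1 * hscal x 1 + p $ 2 * hscal x 2 + p $ 3 * hscal x 3" for p x
  proof -
    have "f_VI p $ Inl j = p $ j" "f_VI p $ Inr (j, None) = 0" "f_VI p $ Inr (j, Some k) = 0" for j k
      using f_VI_components[of p j] by (simp_all add: hscal_def hoct_def prod_eq_iff vec_eq_iff)
    then show "b x (f_VI p) = p $ 1 * hscal x 1 + p $ 2 * hscal x 2 + p $ 3 * hscal x 3"
      "b (f_VI p) x = p $ 1 * hscal x 1 + p $ 2 * hscal x 2 + p $ 3 * hscal x 3"
      by (simp_all add: b_def sum_hspace sum_3 hscal_def)
  qed
  have c: "cubic_form z = b (sharp z) z / 3" for z by (simp add: cubic_form_eq_sum b_def)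
  have "dderiv cubic_form (f_VI p) w = (b (sharp_deriv p w) (f_VI p) + b (sharp (f_VI p)) w) / 3"
    by (rule cpoly_dderivI[OF cpoly_cubic_form, where a = "cubic_form (f_VI p)"
          and c = "(b (sharp w) (f_VI p) + b (sharp_deriv p w) w) / 3" and d = "cubic_form w"])
       (simp add: c sharp_taylor b algebra_simps power2_eq_square power3_eq_cube add_divide_distrib)
  also have "\<dots> = p $ 2 * p $ 3 * hscal w 1 + p $ 3 * p $ 1 * hscal w 2 + p $ 1 * p $ 2 * hscal w 3"
    unfolding sharp_f_VI bf by (simp add: sharp_deriv_def field_simps)
  finally show ?thesis .
qed

definition oct_norm2 :: "octc \<Rightarrow> real"
  where "oct_norm2 Z = (cmod (fst Z))\<^sup>2 + (\<Sum>k\<in>UNIV. (cmod (snd Z $ k))\<^sup>2)"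

lemma oct_dot_cnj: "oct_dot Z (oct_cnj Z) = oct_norm2 Z"
  unfolding oct_norm2_def of_real_add of_real_sum complex_norm_square
  by (simp add: oct_dot_def oct_cnj_def bdot_def)

lemma oct_norm2_nonneg: "0 \<le> oct_norm2 Z"
  by (simp add: oct_norm2_def sum_nonneg)

lemma oct_norm2_eq_0: "oct_norm2 Z = 0 \<longleftrightarrow> Z = 0"
  by (simp add: oct_norm2_def add_nonneg_eq_0_iff sum_nonneg sum_nonneg_eq_0_iff prod_eq_iff vec_eq_iff)

lemma oct_norm2_simps:
  "oct_norm2 (oct_scale c Z) = (cmod c)\<^sup>2 * oct_norm2 Z"
  "oct_norm2 (cayley_conj Z) = oct_norm2 Z"
  by (simp_all add: oct_norm2_def oct_scale_def cayley_conj_def norm_mult power_mult_distrib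
      sum_distrib_left distrib_left)

text \<open>The diagonal block is the Poincare metric of the polydisk. On the \<open>j\<close>-th octonionic block the
  Hessian of the norm is \<open>-(1 - |p\<^sub>j|\<^sup>2)\<close> times the identity, and \<open>\<partial>N\<close> vanishes there by the absence of
  linear terms, so dividing by \<open>N\<close> gives the second sum.\<close>

lemma metric_at_f_VI:
  assumes p: "p \<in> polydisk"
  shows "g_Omega_VI (f_VI p) w w =
    (\<Sum>j\<in>UNIV. (cmod (hscal w j))\<^sup>2 / (defect p j)\<^sup>2)
    + (\<Sum>j\<in>UNIV. defect p j * oct_norm2 (hoct w j)) / (defect p 1 * defect p 2 * defect p 3)"
proof -
  define n where "n j = complex_of_real (defect p j)" for j
  define x where "x j = hscal w j" for j
  define a where "a j = p $ j" for j
  define R where "R = (\<Sum>j\<in>UNIV. n j * complex_of_real (oct_norm2 (hoct w j)))"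
  have n: "n j = 1 - a j * cnj (a j)" for j
    by (simp add: n_def a_def flip: complex_norm_square)
  have n0: "n j \<noteq> 0" for j 
    using p unfolding polydisk_defect n_def of_real_eq_0_iff by (metis less_irrefl)
  have del: "VI.del (f_VI p) w =
      - (x 1 * cnj (a 1) * n 2 * n 3 + x 2 * cnj (a 2) * n 3 * n 1 + x 3 * cnj (a 3) * n 1 * n 2)"
  proof -
    have "VI.del (f_VI p) w = - hform w (f_VI p) + hform (sharp_deriv p w) (sharp (f_VI p))
       - dderiv cubic_form (f_VI p) w * cnj (cubic_form (f_VI p))"
      unfolding VI.del_def sum_norm_term_index
      by (simp add: dderiv_sharp dderiv_coord hform_eq_sum sum_negf)
    also have "\<dots> = - (x 1 * cnj (a 1) * n 2 * n 3 + x 2 * cnj (a 2) * n 3 * n 1 + x 3 * cnj (a 3) * n 1 * n 2)"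
      unfolding n dderiv_cubic_form cubic_form_f_VI sharp_f_VI
      by (simp add: hform_def sum_3 sharp_deriv_def x_def a_def algebra_simps)
    finally show ?thesis .
  qed
  have hess: "VI.hess (f_VI p) w w =
      - (x 1 * cnj (x 1) * n 2 * n 3 + x 2 * cnj (x 2) * n 3 * n 1 + x 3 * cnj (x 3) * n 1 * n 2)
      + n 3 * (x 1 * cnj (a 1) * cnj (x 2) * a 2 + x 2 * cnj (a 2) * cnj (x 1) * a 1)
      + n 1 * (x 2 * cnj (a 2) * cnj (x 3) * a 3 + x 3 * cnj (a 3) * cnj (x 2) * a 2)
      + n 2 * (x 3 * cnj (a 3) * cnj (x 1) * a 1 + x 1 * cnj (a 1) * cnj (x 3) * a 3) - R"
  proof -
    have "VI.hess (f_VI p) w w = - hform w w + hform (sharp_deriv p w) (sharp_deriv p w)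
       - dderiv cubic_form (f_VI p) w * cnj (dderiv cubic_form (f_VI p) w)"
      unfolding VI.hess_def sum_norm_term_index
      by (simp add: dderiv_sharp dderiv_coord hform_eq_sum sum_negf)
    also have "hform w w = (\<Sum>j\<in>UNIV. x j * cnj (x j)) + (\<Sum>j\<in>UNIV. complex_of_real (oct_norm2 (hoct w j)))"
      unfolding hform_def x_def oct_dot_cnj ..
    also have "hform (sharp_deriv p w) (sharp_deriv p w) =
      (a 2 * x 3 + a 3 * x 2) * cnj (a 2 * x 3 + a 3 * x 2) +
      (a 3 * x 1 + a 1 * x 3) * cnj (a 3 * x 1 + a 1 * x 3) +
      (a 1 * x 2 + a 2 * x 1) * cnj (a 1 * x 2 + a 2 * x 1) +
      (\<Sum>j\<in>UNIV. a j * cnj (a j) * complex_of_real (oct_norm2 (hoct w j)))"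
      unfolding hform_def oct_dot_cnj sum_3
      by (simp add: sharp_deriv_def oct_norm2_simps x_def a_def flip: complex_norm_square)
    finally show ?thesis
      unfolding R_def n dderiv_cubic_form sum_3
      by (simp add: x_def[symmetric] a_def[symmetric] algebra_simps)
  qed
  have N: "complex_of_real (Re (generic_norm_VI (f_VI p) (f_VI p))) = n 1 * n 2 * n 3"
    unfolding generic_norm_f_VI n_def by simp
  have cn: "cnj (n j) = n j" for j by (simp add: n_def)
  have an: "a j * cnj (a j) = 1 - n j" for j by (simp add: n)
  have "VI.levi (f_VI p) w w = - ((\<Sum>j\<in>UNIV. x j * cnj (x j) / (n j)\<^sup>2) + R / (n 1 * n 2 * n 3))"
  proof -
    \<comment> \<open>The mixed products of different coordinates cancel. What is left carries the factors
      \<open>n j + |a j|\<^sup>2 = 1\<close>.\<close>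
    have e: "(n 1 * n 2 * n 3) * (VI.hess (f_VI p) w w + R) - VI.del (f_VI p) w * cnj (VI.del (f_VI p) w)
      = - (x 1 * cnj (x 1) * (n 2 * n 3)\<^sup>2 * (n 1 + a 1 * cnj (a 1))
         + x 2 * cnj (x 2) * (n 3 * n 1)\<^sup>2 * (n 2 + a 2 * cnj (a 2))
         + x 3 * cnj (x 3) * (n 1 * n 2)\<^sup>2 * (n 3 + a 3 * cnj (a 3)))"
      unfolding hess del by (simp add: cn power2_eq_square algebra_simps)
    have "VI.levi (f_VI p) w w = ((n 1 * n 2 * n 3) * (VI.hess (f_VI p) w w + R)
       - VI.del (f_VI p) w * cnj (VI.del (f_VI p) w)) / (n 1 * n 2 * n 3)\<^sup>2 - R / (n 1 * n 2 * n 3)"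
      unfolding VI.levi_def N of_real_power using n0
      by (simp add: field_simps power2_eq_square)
    also have "\<dots> = - (\<Sum>j\<in>UNIV. x j * cnj (x j) / (n j)\<^sup>2) - R / (n 1 * n 2 * n 3)"
      unfolding e an sum_3 using n0 by (simp add: field_simps power2_eq_square)
    finally show ?thesis by simp
  qed
  also have "\<dots> = - complex_of_real ((\<Sum>j\<in>UNIV. (cmod (hscal w j))\<^sup>2 / (defect p j)\<^sup>2)
    + (\<Sum>j\<in>UNIV. defect p j * oct_norm2 (hoct w j)) / (defect p 1 * defect p 2 * defect p 3))"
    unfolding R_def n_def x_def complex_norm_square[symmetric] by simp
  finally show ?thesis
    unfolding g_Omega_VI_def VI.kaehler_metric_eq[OF generic_norm_pos[OF p]]
    by (simp only: minus_minus Re_complex_of_real uminus_complex.sel)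
qed

lemma bilinear_metric:
  assumes "0 < Re (generic_norm_VI q q)"
  shows "bilinear (g_Omega_VI q)"
  unfolding g_Omega_VI_def VI.kaehler_metric_eq[OF assms] bilinear_def
  by (auto intro!: linearI simp: scaleR_eq_cscale VI.levi_add_left VI.levi_add_right VI.levi_scale_left
      VI.levi_scale_right)

lemma metric_positive:
  assumes p: "p \<in> polydisk" and "w \<noteq> 0"
  shows "0 < g_Omega_VI (f_VI p) w w"
proof -
  have d: "0 < defect p j" for j using p polydisk_defect by blast
  let ?A = "\<Sum>j\<in>UNIV. (cmod (hscal w j))\<^sup>2 / (defect p j)\<^sup>2"
  let ?B = "\<Sum>j\<in>UNIV. defect p j * oct_norm2 (hoct w j)"
  have A: "0 \<le> ?A" by (simp add: sum_nonneg)
  have B: "0 \<le> ?B" using d by (intro sum_nonneg mult_nonneg_nonneg oct_norm2_nonneg less_imp_le)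
  have D: "0 < defect p 1 * defect p 2 * defect p 3" using d by (intro mult_pos_pos)
  have "0 < ?A \<or> 0 < ?B"
  proof (rule ccontr)
    assume "\<not> (0 < ?A \<or> 0 < ?B)"
    then have "?A = 0" "?B = 0" using A B by auto
    then have "\<forall>j. (cmod (hscal w j))\<^sup>2 / (defect p j)\<^sup>2 = 0" "\<forall>j. defect p j * oct_norm2 (hoct w j) = 0"
      using d by (simp_all add: sum_nonneg_eq_0_iff oct_norm2_nonneg less_imp_le del: mult_eq_0_iff divide_eq_0_iff)
    moreover have "defect p j \<noteq> 0" for j using d[of j] by linarith
    ultimately have "\<forall>j. hscal w j = 0" "\<forall>j. hoct w j = 0"
      by (simp_all add: oct_norm2_eq_0)
    then have "w = 0" by (intro hspace_eqI) (simp_all add: hscal_def hoct_def prod_eq_iff vec_eq_iff)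
    then show False using assms(2) by simp
  qed
  then show ?thesis
  proof
    assume "0 < ?A"
    then show ?thesis unfolding metric_at_f_VI[OF p] using B D
      by (intro add_pos_nonneg divide_nonneg_pos)
  next
    assume "0 < ?B"
    then show ?thesis unfolding metric_at_f_VI[OF p] using A D
      by (intro add_nonneg_pos divide_pos_pos)
  qed
qed

section \<open>Sign changes on the octonions\<close>

text \<open>Changing the sign of two of the three octonions is a symmetry of the generic norm. The
  common fixed points of these symmetries form the subspace that contains the polydisk.\<close>

definition signs :: "(3 \<Rightarrow> real) \<Rightarrow> hspace \<Rightarrow> hspace"
  where "signs s z = (\<chi> i. case i of Inl j \<Rightarrow> z $ i | Inr (j, k) \<Rightarrow> s j * z $ i)"

lemma signs_components [simp]:
  "hscal (signs s z) j = hscal z j" "hoct (signs s z) j = oct_scale (s j) (hoct z j)"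
  by (simp_all add: signs_def hscal_def hoct_def oct_scale_def prod_eq_iff vec_eq_iff)

lemma signs_clinear: "Vector_Spaces.linear (*s) (*s) (signs s)"
  by unfold_locales (auto intro!: hspace_eqI simp: oct_scale_simps mult_ac algebra_simps)

text \<open>The product of two different signs is the third one, as the terms \<open>Z\<^sub>2 Z\<^sub>3\<close> and the conjugate of
  \<open>Z\<^sub>1\<close> in the adjoint require. Hence the adjoint is equivariant.\<close>

lemma generic_norm_signs:
  assumes s: "\<And>j. s j * s j = 1" and prod: "s 1 * s 2 * s 3 = 1"
  shows "generic_norm_VI (signs s z) (signs s z) = generic_norm_VI z z"
proof -
  have s': "complex_of_real (s j) * complex_of_real (s j) = 1" for j
    using s[of j] by (metis of_real_1 of_real_mult)
  have "s 2 * s 3 = s 1" "s 3 * s 1 = s 2" "s 1 * s 2 = s 3"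
    using s[of 1] s[of 2] s[of 3] prod by algebra+
  then have s3: "complex_of_real (s 2) * complex_of_real (s 3) = s 1"
    "complex_of_real (s 3) * complex_of_real (s 1) = s 2"
    "complex_of_real (s 1) * complex_of_real (s 2) = s 3" by (metis of_real_mult)+
  have sh: "sharp (signs s x) = signs s (sharp x)" for x
    by (rule hspace_eqI3)
       (simp_all add: sharp_simps oct_scale_simps s' s3, simp_all add: mult_ac)
  have hc: "hcnj (signs s x) = signs s (hcnj x)" for x
    by (rule hspace_eqI) (simp_all add: hcnj_simps flip: oct_cnj_simps(3))
  have hf: "hform (signs s x) (signs s y) = hform x y" for x y
    unfolding hform_def by (simp add: oct_scale_simps s' flip: oct_cnj_simps(3))
  show ?thesis unfolding generic_norm_eq cubic_form_def sh hc hf ..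
qed

text \<open>One sign change alone fixes one octonion. Two of them are enough to force all three octonions
  of the Christoffel vector to vanish.\<close>

lemma christoffel_tangent:
  assumes p: "p \<in> polydisk"
  shows "christoffel g_Omega_VI (f_VI p) (f_VI u) (f_VI v) \<in> range f_VI"
proof -
  let ?w = "christoffel g_Omega_VI (f_VI p) (f_VI u) (f_VI v)"
  have "signs s ?w = ?w" if s: "\<And>j. s j * s j = 1" and prod: "s 1 * s 2 * s 3 = 1" for s
  proof (rule christoffel_fixed[where S = "{z. 0 < Re (generic_norm_VI z z)}"])
    show "linear (signs s)" by (rule clinear_imp_linear[OF signs_clinear])
    have "complex_of_real (s j) * complex_of_real (s j) = 1" for j
      using s[of j] by (metis of_real_1 of_real_mult)
    then show "signs s (signs s x) = x" for x
      by (intro hspace_eqI) (simp_all add: oct_scale_simps)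
    have fixed: "signs s (f_VI x) = f_VI x" for x by (rule hspace_eqI) simp_all
    show "signs s (f_VI p) = f_VI p" "signs s (f_VI u) = f_VI u" "signs s (f_VI v) = f_VI v" by (rule fixed)+
    show "g_Omega_VI (signs s q) (signs s x) (signs s y) = g_Omega_VI q x y"
      if "q \<in> {z. 0 < Re (generic_norm_VI z z)}" for q x y
      using VI.pullback[OF signs_clinear, of s q x y] that
      by (simp add: generic_norm_signs[of s, OF s prod] g_Omega_VI_def)
    show "(\<lambda>q. g_Omega_VI q x y) differentiable (at (f_VI p))" for x y
      unfolding g_Omega_VI_def by (rule VI.differentiable_metric[OF generic_norm_pos[OF p]])
  qed (use VI.open_positive generic_norm_pos[OF p] metric_positive[OF p] bilinear_metric in auto)
  \<comment> \<open>The signs \<open>(1, -1, -1)\<close> and \<open>(-1, 1, -1)\<close>: each \<open>j\<close> is negated by one of them.\<close>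
  from this[of "\<lambda>j. if j = 1 then 1 else -1"] this[of "\<lambda>j. if j = 2 then 1 else -1"]
  have 1: "signs (\<lambda>j. if j = 1 then 1 else -1) ?w = ?w" "signs (\<lambda>j. if j = 2 then 1 else -1) ?w = ?w"
    by auto
  have z: "Z = 0" if "oct_scale (-1) Z = Z" for Z
    using that by (auto simp: oct_scale_def prod_eq_iff vec_eq_iff)
  have "hoct ?w j = 0" for j
  proof (cases "j = 1")
    case True
    then show ?thesis using z arg_cong[OF 1(2), of "\<lambda>x. hoct x j"] by simp
  next
    case False
    then show ?thesis using z arg_cong[OF 1(1), of "\<lambda>x. hoct x j"] by simp
  qed
  then show ?thesis unfolding range_f_VI by blast
qed

section \<open>The embedding of the polydisk and the rank\<close>

text \<open>The covariant derivative is tangent to the image, so it is its own tangential part. Positivity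
  of the metric makes the normal part unique, so it is zero.\<close>

lemma totally_geodesic_f_VI: "totally_geodesic polydisk g_Omega_VI f_VI"
  unfolding totally_geodesic_def
proof (intro ballI allI)
  fix p u v :: "complex ^ 3" assume p: "p \<in> polydisk"
  have cov: "covariant_deriv_along g_Omega_VI f_VI p u v \<in> range f_VI"
    using christoffel_tangent[OF p] by (simp add: covariant_deriv_along_def dderiv_f_VI)
  have bil: "linear (\<lambda>n. g_Omega_VI (f_VI p) n x)" for x
    using bilinear_metric[OF generic_norm_pos[OF p]] by (simp add: bilinear_def)
  show "second_fundamental_form g_Omega_VI f_VI p u v = 0"
    unfolding second_fundamental_form_def dderiv_f_VI
  proof (rule the_equality)
    show "(\<forall>t. g_Omega_VI (f_VI p) 0 (f_VI t) = 0) \<and>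
        covariant_deriv_along g_Omega_VI f_VI p u v - 0 \<in> range f_VI"
      using cov linear_0[OF bil] by simp
    fix n assume n: "(\<forall>t. g_Omega_VI (f_VI p) n (f_VI t) = 0) \<and>
        covariant_deriv_along g_Omega_VI f_VI p u v - n \<in> range f_VI"
    obtain c where c: "covariant_deriv_along g_Omega_VI f_VI p u v = f_VI c" using cov by blast
    obtain d where "f_VI c - n = f_VI d" using n c by auto
    then have nf: "n = f_VI (c - d)"
      unfolding linear_diff[OF linear_f_VI] by (metis diff_diff_eq2 add_diff_cancel_left')
    then have "g_Omega_VI (f_VI p) n n = 0" using n by blast
    then show "n = 0" using metric_positive[OF p, of n] by fastforce
  qed
qed

lemma inj_f_VI: "inj f_VI"
  by (rule injI) (metis f_VI_components(1) vec_eq_iff)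

lemma holomorphic_f_VI: "holomorphic_map polydisk Omega_VI f_VI"
proof -
  interpret f: Vector_Spaces.linear "(*s)" "(*s)" f_VI by (rule f_VI_clinear)
  show ?thesis unfolding holomorphic_map_def dderiv_f_VI
    using f_VI_mem_Omega f_VI_has_derivative differentiableI f.scale by blast
qed

lemma isometric_f_VI: "isometric_embedding polydisk g_polydisk Omega_VI g_Omega_VI f_VI"
  unfolding isometric_embedding_def dderiv_f_VI
proof (intro conjI ballI allI)
  show "f_VI ` polydisk \<subseteq> Omega_VI" using f_VI_mem_Omega by auto
  have "homeomorphism polydisk (f_VI ` polydisk) f_VI (\<lambda>z. \<chi> j. hscal z j)"
  proof (rule homeomorphismI)
    show "continuous_on polydisk f_VI"
      using linear_continuous_on linear_f_VI linear_conv_bounded_linear by blast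
    show "continuous_on (f_VI ` polydisk) (\<lambda>z. \<chi> j. hscal z j)"
      unfolding hscal_def by (intro continuous_intros)
  qed auto
  then show "\<exists>f'. homeomorphism polydisk (f_VI ` polydisk) f_VI f'"
    by (rule exI[where x = "\<lambda>z. \<chi> j. hscal z j"])
  show "f_VI differentiable (at p)" for p using f_VI_has_derivative differentiableI by blast
  show "inj f_VI" by (rule inj_f_VI)
  fix p u v :: "complex ^ 3" assume p: "p \<in> polydisk"
  have "(\<lambda>z. \<Prod>j\<in>UNIV. defect z j) = (\<lambda>z :: complex ^ 3. Re (generic_norm_VI (f_VI z) (f_VI z)))"
    unfolding generic_norm_f_VI prod_3 ..
  then show "g_polydisk p u v = g_Omega_VI (f_VI p) (f_VI u) (f_VI v)"
    unfolding g_polydisk_def g_Omega_VI_def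
    using VI.pullback[OF f_VI_clinear generic_norm_pos[OF p]] by simp
qed

text \<open>The norm of \<open>t z\<close> is a cubic in \<open>t\<close>, because the adjoint is quadratic. At the unit element
  \<open>(1, 1, 1, 0, 0, 0)\<close> it is \<open>(1 - t)\<^sup>3\<close>, so the degree 3 is attained.\<close>

lemma rank_VI: "rank_Omega_VI = 3"
  unfolding rank_Omega_VI_def generic_norm_rank_def
proof (rule Least_equality)
  show "\<forall>z w. \<exists>q :: complex poly. degree q \<le> 3 \<and> (\<forall>t. poly q t = generic_norm_VI (t *s z) w)"
  proof (intro allI)
    fix z w
    let ?q = "[:1, - hform z w, hform (sharp z) (sharp w), - (cubic_form z * cnj (cubic_form w)):]"
    have h: "hform (c *s x) y = c * hform x y" for c x y
      by (simp add: hform_eq_sum sum_distrib_left mult_ac)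
    have "cubic_form (t *s z) = t ^ 3 * cubic_form z" for t
      by (simp add: cubic_form_eq_sum sharp_scale sum_distrib_left mult_ac power2_eq_square power3_eq_cube)
    then have "poly ?q t = generic_norm_VI (t *s z) w" for t
      unfolding generic_norm_eq sharp_scale h
      by (simp add: algebra_simps power2_eq_square power3_eq_cube)
    moreover have "degree ?q \<le> 3" by (auto simp: degree_pCons_eq_if)
    ultimately show "\<exists>q :: complex poly. degree q \<le> 3 \<and> (\<forall>t. poly q t = generic_norm_VI (t *s z) w)"
      by blast
  qed
next
  fix r assume r: "\<forall>z w. \<exists>q :: complex poly. degree q \<le> r \<and> (\<forall>t. poly q t = generic_norm_VI (t *s z) w)"
  let ?e = "f_VI (vector [1, 1, 1])"
  obtain q :: "complex poly" where q: "degree q \<le> r" "\<forall>t. poly q t = generic_norm_VI (t *s ?e) ?e"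
    using r by blast
  have te: "t *s ?e = f_VI (vector [t, t, t])" for t
    by (rule hspace_eqI3) (simp_all add: oct_scale_simps)
  have "poly q t = poly ([:1, -1:] ^ 3) t" for t
    unfolding q(2)[rule_format] te generic_norm_eq cubic_form_f_VI sharp_f_VI
    by (simp add: hform_def sum_3 algebra_simps power2_eq_square power3_eq_cube)
  then have "q = [:1, -1:] ^ 3" by (metis poly_eq_poly_eq_iff ext)
  then have "degree q = 3" by (simp add: degree_power_eq)
  then show "3 \<le> r" using q(1) by simp
qed

theorem proposition2p1:
  shows "holomorphic_map polydisk Omega_VI f_VI
       \<and> isometric_embedding polydisk g_polydisk Omega_VI g_Omega_VI f_VI
       \<and> totally_geodesic polydisk g_Omega_VI f_VI
       \<and> f_VI ` polydisk = {z \<in> Omega_VI. hoct z 1 = 0 \<and> hoct z 2 = 0 \<and> hoct z 3 = 0}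
       \<and> totally_geodesic_polydisk TYPE(3) Omega_VI g_Omega_VI
            {z \<in> Omega_VI. hoct z 1 = 0 \<and> hoct z 2 = 0 \<and> hoct z 3 = 0}
       \<and> CARD(3) = rank_Omega_VI \<and> rank_Omega_VI = 3"
proof -
  have "totally_geodesic_polydisk TYPE(3) Omega_VI g_Omega_VI (f_VI ` polydisk)"
    unfolding totally_geodesic_polydisk_def
    using holomorphic_f_VI isometric_f_VI totally_geodesic_f_VI by blast
  then show ?thesis
    using holomorphic_f_VI isometric_f_VI totally_geodesic_f_VI image_f_VI rank_VI by simp
qed

end
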